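(* Let $N\ge2$, $\omega\in\mathbb{R}$ and $\gamma^*(N):=N\,\mathrm{erf}^{-1}(1-2/N)$. Then for every $\gamma>\gamma^*(N)$ there exists a minimizer of $d_\gamma(\omega)$. Moreover, the set of ground states is $\mathcal{G}_{\omega,\gamma}=\{e^{i\theta}\phi^0_{\omega,\gamma}:\theta\in\mathbb{R}\}$, where $\phi^0_{\omega,\gamma}$ is the function on $\Gamma$ all of whose components equal $x\mapsto e^{\frac{\omega+1}{2}}e^{-\frac12(x+\gamma/N)^2}$.
   Context: $\mathrm{erf}(s)=\frac{2}{\sqrt\pi}\int_0^se^{-t^2}dt$, and $\mathrm{erf}^{-1}:[0,1)\to[0,\infty)$ its inverse. The star graph $\Gamma$ consists of $N$ half-lines $(0,\infty)$ joined at $x=0$; functions on $\Gamma$ are tuples $u=(u_e)_{e=1}^N$, $u_e(0)=\lim_{x\to0^+}u_e(x)$, $\int_\Gamma F(u)dx=\sum_e\int_0^\infty F(u_e)dx$, $\|u\|^2_{L^2(\Gamma)}=\sum_e\|u_e\|^2_{L^2(\mathbb{R}^+)}$. $H^1(\Gamma)$: $u_e\in H^1(\mathbb{R}^+)$ for all $e$ and $u_1(0)=\dots=u_N(0)$. $W(\Gamma)=\{u\in H^1(\Gamma):|u_e|^2\log|u_e|^2\in L^1(\mathbb{R}^+)\ \forall e\}$ (a Banach space normed by $\|u\|^2_{W}=\sum_e(\|u_e\|_{H^1}+\|u_e\|_{L^A})^2$, with $L^A$ the Orlicz space of $A(s)=-s^2\log s^2$ for $s\le e^{-3}$, $A(s)=3s^2+4e^{-3}s-e^{-6}$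 for $s\ge e^{-3}$, Luxemburg norm). $\mathfrak{F}_\gamma[u]=\sum_e\int_0^\infty|\partial_xu_e|^2dx-\gamma|u_1(0)|^2$. For $u\in W(\Gamma)$: $S_{\omega,\gamma}(u)=\frac12\mathfrak{F}_\gamma[u]+\frac{\omega+1}{2}\|u\|^2_{L^2(\Gamma)}-\frac12\int_\Gamma|u|^2\log|u|^2dx$, $I_{\omega,\gamma}(u)=\mathfrak{F}_\gamma[u]+\omega\|u\|^2_{L^2(\Gamma)}-\int_\Gamma|u|^2\log|u|^2dx$, $d_\gamma(\omega)=\inf\{S_{\omega,\gamma}(u):u\in W(\Gamma)\setminus\{0\},\ I_{\omega,\gamma}(u)=0\}$ (equal to $\frac12\inf\{\|u\|^2_{L^2(\Gamma)}:u\in W(\Gamma)\setminus\{0\},I_{\omega,\gamma}(u)=0\}$). A minimizer of $d_\gamma(\omega)$ is $u\in W(\Gamma)\setminus\{0\}$ with $I_{\omega,\gamma}(u)=0$ and $S_{\omega,\gamma}(u)=d_\gamma(\omega)$; $\mathcal{G}_{\omega,\gamma}$ denotes the set of all such minimizers (ground states). *)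

theory Defs
  imports "HOL-Analysis.Analysis"
begin

definition erf :: "real \<Rightarrow> real" where
  "erf s = 2 / sqrt pi * integral {0..s} (\<lambda>t. exp (- (t^2)))"

definition erf_inv :: "real \<Rightarrow> real" where
  "erf_inv y = (THE s. s \<ge> 0 \<and> erf s = y)"

definition gamma_star :: "nat \<Rightarrow> real" where
  "gamma_star N = real N * erf_inv (1 - 2 / real N)"

(* g is the weak derivative of f on the half-line [0,\<infinity>) (absolutely continuous
   representative of f: f x = f 0 + \<integral>_0^x g) *)
definition weak_deriv :: "(real \<Rightarrow> complex) \<Rightarrow> (real \<Rightarrow> complex) \<Rightarrow> bool" where
  "weak_deriv f g \<longleftrightarrow>
     (\<forall>x\<ge>0. set_integrable lborel {0..x} g \<and> f x = f 0 + (LINT t:{0..x}|lborel. g t))"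

definition L2_half :: "(real \<Rightarrow> complex) \<Rightarrow> bool" where
  "L2_half f \<longleftrightarrow> set_integrable lborel {0<..} (\<lambda>x. (cmod (f x))^2)"

(* H^1(R^+), functions represented by their continuous representative on [0,\<infinity>) *)
definition H1_half :: "(real \<Rightarrow> complex) \<Rightarrow> bool" where
  "H1_half f \<longleftrightarrow> L2_half f \<and> (\<exists>g. weak_deriv f g \<and> L2_half g)"

definition dirichlet_half :: "(real \<Rightarrow> complex) \<Rightarrow> real" where
  "dirichlet_half f = (LINT x:{0<..}|lborel. (cmod ((SOME g. weak_deriv f g \<and> L2_half g) x))^2)"

(* Functions on the star graph with N edges: u e is the component on edge e, e \<in> {1..N} *)
type_synonym graph_fun = "nat \<Rightarrow> real \<Rightarrow> complex"

definition H1_star :: "nat \<Rightarrow> graph_fun \<Rightarrow> bool" where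
  "H1_star N u \<longleftrightarrow> (\<forall>e\<in>{1..N}. H1_half (u e)) \<and> (\<forall>e\<in>{1..N}. u e 0 = u 1 0)"

definition W_star :: "nat \<Rightarrow> graph_fun \<Rightarrow> bool" where
  "W_star N u \<longleftrightarrow> H1_star N u \<and>
     (\<forall>e\<in>{1..N}. set_integrable lborel {0<..}
         (\<lambda>x. (cmod (u e x))^2 * ln ((cmod (u e x))^2)))"

definition is_zero_star :: "nat \<Rightarrow> graph_fun \<Rightarrow> bool" where
  "is_zero_star N u \<longleftrightarrow> (\<forall>e\<in>{1..N}. \<forall>x\<ge>0. u e x = 0)"

definition L2_norm_sq :: "nat \<Rightarrow> graph_fun \<Rightarrow> real" where
  "L2_norm_sq N u = (\<Sum>e=1..N. LINT x:{0<..}|lborel. (cmod (u e x))^2)"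

definition entropy_int :: "nat \<Rightarrow> graph_fun \<Rightarrow> real" where
  "entropy_int N u = (\<Sum>e=1..N. LINT x:{0<..}|lborel. (cmod (u e x))^2 * ln ((cmod (u e x))^2))"

definition F_form :: "nat \<Rightarrow> real \<Rightarrow> graph_fun \<Rightarrow> real" where
  "F_form N \<gamma> u = (\<Sum>e=1..N. dirichlet_half (u e)) - \<gamma> * (cmod (u 1 0))^2"

definition S_act :: "nat \<Rightarrow> real \<Rightarrow> real \<Rightarrow> graph_fun \<Rightarrow> real" where
  "S_act N \<omega> \<gamma> u = F_form N \<gamma> u / 2 + (\<omega> + 1) / 2 * L2_norm_sq N u - entropy_int N u / 2"

definition I_nehari :: "nat \<Rightarrow> real \<Rightarrow> real \<Rightarrow> graph_fun \<Rightarrow> real" where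
  "I_nehari N \<omega> \<gamma> u = F_form N \<gamma> u + \<omega> * L2_norm_sq N u - entropy_int N u"

definition d_level :: "nat \<Rightarrow> real \<Rightarrow> real \<Rightarrow> real" where
  "d_level N \<omega> \<gamma> = Inf {S_act N \<omega> \<gamma> u | u. W_star N u \<and> \<not> is_zero_star N u \<and> I_nehari N \<omega> \<gamma> u = 0}"

definition ground_state :: "nat \<Rightarrow> real \<Rightarrow> real \<Rightarrow> graph_fun \<Rightarrow> bool" where
  "ground_state N \<omega> \<gamma> u \<longleftrightarrow> W_star N u \<and> \<not> is_zero_star N u \<and> I_nehari N \<omega> \<gamma> u = 0
      \<and> S_act N \<omega> \<gamma> u = d_level N \<omega> \<gamma>"

definition phi0 :: "nat \<Rightarrow> real \<Rightarrow> real \<Rightarrow> real \<Rightarrow> real" where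
  "phi0 N \<omega> \<gamma> x = exp ((\<omega> + 1) / 2) * exp (- ((x + \<gamma> / real N)^2) / 2)"

end

(* Rescale the amplitude so that omega + 1 = 0 and write G(r) = - r^2 ln(r^2). With psi(z) = int_0^|z| sqrt G,
   the field "drift" is the gradient of psi, and completing the square along an edge gives
     int |f'|^2 + G(|f|) = 2 psi(f 0) + int |f' + drift f|^2   if |f| <= 1,
   with the better bound 4 psi(1) - 2 psi(f 0) if |f| reaches 1. On the Nehari set the squared norm is the
   maximum of the energy along the ray of positive multiples of u, so it suffices to find one good multiple.
   If |u| stays below the height 1 after normalising the vertex value to that of the Gaussian, the sum over
   the edges is at least the Gaussian level. Otherwise normalise max |u| to 1; then one edge has to climb from
   the vertex to the height 1 and the energy exceeds either the Gaussian level or sqrt pi, the level of the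
   soliton on the line, and gamma > gamma^* says that the latter is larger than the Gaussian level.
   In the equality case f' = - drift f on every edge, which integrates to a Gaussian. *)
theory Submission
  imports Defs "HOL-Probability.Distributions" "HOL-Real_Asymp.Real_Asymp"
begin

section \<open>Weak derivatives on the half-line\<close>

text \<open>No minimizing sequence and no compactness enter: the Gaussian level is an explicit lower
  bound, and the Gaussian attains it. The shift a = \<gamma> / N comes from the vertex: exp (- (x +
  a)^2 / 2) has logarithmic slope - a at 0, and N such slopes balance the coupling \<gamma>. For the
  same reason the vertex term cancels the boundary part of the N edge costs exactly. What remains is
  N times the integral of exp (- t^2) over [a, \<infinity>), and this is how erf gets into the
  threshold. Height 1 is special because G changes sign there. The square can be completed only
  where |f| \<le> 1, so fixing the vertex value is possible only if it does not push |f| above 1.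
  Two points of regularity shape the rest. The functions are only weakly differentiable, so the
  derivative of psi along f needs a chain rule for C^1 functions of weakly differentiable curves.
  And \<open>drift\<close> is not Lipschitz at 0, so in the equality case it has to be shown by hand
  that the solution cannot reach 0.\<close>

lemma half_line_integrable_iff:
  fixes h :: "real \<Rightarrow> 'a::{banach, second_countable_topology}"
  shows "set_integrable lborel {0<..} h \<longleftrightarrow> set_integrable lborel {0..} h"
  by (rule set_integrable_discrete_difference[where X="{0}"]) auto

lemma half_line_integral_eq:
  fixes h :: "real \<Rightarrow> 'a::{banach, second_countable_topology}"
  shows "(LINT x:{0<..}|lborel. h x) = (LINT x:{0..}|lborel. h x)"
  by (rule set_integral_discrete_difference[where X="{0}"]) auto

lemma set_integral_Icc_combine:
  fixes h :: "real \<Rightarrow> 'a::euclidean_space"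
  assumes "a \<le> b" "b \<le> c" "set_integrable lborel {a..c} h"
  shows "(LINT x:{a..c}|lborel. h x) = (LINT x:{a..b}|lborel. h x) + (LINT x:{b..c}|lborel. h x)"
proof -
  have "set_integrable lborel {a..b} h" "set_integrable lborel {b..c} h"
    using assms by (auto intro: set_integrable_subset)
  then show ?thesis
    using assms Henstock_Kurzweil_Integration.integral_combine[of a b c h]
      set_borel_integral_eq_integral[of "{a..c}" h]
    by (simp add: set_borel_integral_eq_integral)
qed

lemma set_integral_abs_bound:
  fixes h :: "real \<Rightarrow> 'a::euclidean_space"
  assumes "set_integrable lborel A h" "set_integrable lborel A k" "\<And>x. x \<in> A \<Longrightarrow> norm (h x) \<le> k x"
  shows "norm (LINT x:A|lborel. h x) \<le> (LINT x:A|lborel. k x)"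
proof -
  have "norm (LINT x:A|lborel. h x) \<le> (LINT x:A|lborel. norm (h x))"
    using assms(1) by (rule set_integral_norm_bound)
  also have "\<dots> \<le> (LINT x:A|lborel. k x)"
    by (rule set_integral_mono) (use assms in \<open>auto intro: set_integrable_norm\<close>)
  finally show ?thesis .
qed

lemma set_integrable_continuous_inner:
  fixes g h :: "real \<Rightarrow> complex"
  assumes "set_integrable lborel {a..b} g" "g \<in> borel_measurable borel" "continuous_on UNIV h"
  shows "set_integrable lborel {a..b} (\<lambda>t. h t \<bullet> g t)"
proof -
  have "compact (h ` {a..b})"
    using assms(3) by (auto intro: compact_continuous_image continuous_on_subset)
  then obtain C where C: "\<And>t. t \<in> {a..b} \<Longrightarrow> norm (h t) \<le> C"
    by (meson bounded_iff compact_imp_bounded imageI)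
  have hm: "h \<in> borel_measurable borel"
    using assms(3) by (rule borel_measurable_continuous_onI)
  show ?thesis
  proof (rule set_integrable_bound)
    show "set_integrable lborel {a..b} (\<lambda>t. C * norm (g t))"
      using assms(1) by (intro set_integrable_mult_right set_integrable_norm)
    show "set_borel_measurable lborel {a..b} (\<lambda>t. h t \<bullet> g t)"
      unfolding set_borel_measurable_def using hm assms(2) by auto
    have "norm (h t \<bullet> g t) \<le> norm (C * norm (g t))" if "t \<in> {a..b}" for t
    proof -
      have "norm (h t \<bullet> g t) \<le> norm (h t) * norm (g t)"
        using Cauchy_Schwarz_ineq2 by auto
      also have "\<dots> \<le> C * norm (g t)"
        using C[OF that] by (intro mult_right_mono) auto
      also have "\<dots> \<le> norm (C * norm (g t))" by simp
      finally show ?thesis .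
    qed
    then show "AE x in lborel. x \<in> {a..b} \<longrightarrow> norm (h x \<bullet> g x) \<le> norm (C * norm (g x))"
      by auto
  qed
qed

lemma weak_deriv_integrable:
  assumes "weak_deriv f g" "0 \<le> x"
  shows "set_integrable lborel {x..y} g"
proof (cases "x \<le> y")
  case True
  then have "set_integrable lborel {0..y} g"
    using assms(1) order_trans[OF assms(2)] unfolding weak_deriv_def by blast
  then show ?thesis by (rule set_integrable_subset) (use assms in auto)
qed simp

lemma weak_deriv_diff:
  assumes "weak_deriv f g" "0 \<le> x" "x \<le> y"
  shows "f y - f x = (LINT t:{x..y}|lborel. g t)"
proof -
  have "f y = f 0 + (LINT t:{0..y}|lborel. g t)" "f x = f 0 + (LINT t:{0..x}|lborel. g t)"
    using assms(1) assms(2) order_trans[OF assms(2,3)] unfolding weak_deriv_def by blast+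
  then show ?thesis
    using set_integral_Icc_combine[OF assms(2,3) weak_deriv_integrable[OF assms(1) order_refl]] by simp
qed

text \<open>The mean value inequality for \<open>\<Psi>\<close> minus the linear map
  \<open>D w\<close>, on a ball where \<open>D\<close> varies by at most \<open>e\<close>. Both
  \<open>z\<close> and \<open>z'\<close> may move while \<open>w\<close> stays fixed: in a bisection
  the small intervals contain the limit point, but need not start there.\<close>

lemma C1_local_linear_bound:
  fixes D :: "complex \<Rightarrow> complex" and \<Psi> :: "complex \<Rightarrow> real"
  assumes der: "\<And>z. (\<Psi> has_derivative (\<lambda>h. D z \<bullet> h)) (at z)" and "continuous_on UNIV D" "e > 0"
  shows "\<exists>d>0. (\<forall>z. dist z w < d \<longrightarrow> norm (D z - D w) \<le> e) \<and>
    (\<forall>z z'. dist z w < d \<and> dist z' w < d \<longrightarrow> \<bar>\<Psi> z' - \<Psi> z - D w \<bullet> (z' - z)\<bar> \<le> e * norm (z' - z))"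
proof -
  have "isCont D w" using assms(2) by (simp add: continuous_on_eq_continuous_at)
  then obtain d where d: "d > 0" "\<And>z. dist z w < d \<Longrightarrow> dist (D z) (D w) < e"
    using \<open>e > 0\<close> unfolding continuous_at_eps_delta by blast
  have "\<bar>\<Psi> z' - \<Psi> z - D w \<bullet> (z' - z)\<bar> \<le> e * norm (z' - z)"
    if z: "dist z w < d" "dist z' w < d" for z z'
  proof -
    let ?F = "\<lambda>z. \<Psi> z - D w \<bullet> z"
    have "norm (?F z' - ?F z) \<le> e * norm (z' - z)"
    proof (rule differentiable_bound[where S="ball w d" and f'="\<lambda>z h. (D z - D w) \<bullet> h"])
      fix x assume x: "x \<in> ball w d"
      have "(?F has_derivative (\<lambda>h. D x \<bullet> h - D w \<bullet> h)) (at x within ball w d)"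
        by (intro derivative_intros has_derivative_at_withinI[OF der])
      then show "(?F has_derivative (\<lambda>h. (D x - D w) \<bullet> h)) (at x within ball w d)"
        by (simp add: inner_diff_left)
      have "norm (D x - D w) \<le> e"
        using d(2)[of x] x by (simp add: dist_norm norm_minus_commute less_imp_le)
      then show "onorm (\<lambda>h. (D x - D w) \<bullet> h) \<le> e"
        by (intro onorm_bound) (auto intro!: order_trans[OF Cauchy_Schwarz_ineq2] mult_right_mono 
              simp: \<open>e > 0\<close> less_imp_le)
    qed (use z in \<open>auto simp: dist_commute\<close>)
    then show ?thesis by (simp add: inner_diff_right algebra_simps)
  qed
  then show ?thesis using d by (intro exI[of _ d]) (auto simp: dist_norm less_imp_le)
qed

text \<open>The error in the chain rule is additive in the interval and, locally, at most a small multiple of the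
  integral of \<open>|g|\<close>, so Bolzano's bisection principle bounds it on the whole interval.\<close>

proposition weak_deriv_chain_rule:
  fixes D :: "complex \<Rightarrow> complex" and \<Psi> :: "complex \<Rightarrow> real"
  assumes wd: "weak_deriv f g" and cf: "continuous_on UNIV f" and mg: "g \<in> borel_measurable borel"
    and der: "\<And>z. (\<Psi> has_derivative (\<lambda>h. D z \<bullet> h)) (at z)" and cD: "continuous_on UNIV D"
    and xy: "0 \<le> x" "x \<le> y"
  shows "\<Psi> (f y) - \<Psi> (f x) = (LINT t:{x..y}|lborel. D (f t) \<bullet> g t)"
proof -
  have cDf: "continuous_on UNIV (\<lambda>t. D (f t))"
    using continuous_on_compose2[OF cD cf] by auto
  have int: "set_integrable lborel {a..b} (\<lambda>t. D (f t) \<bullet> g t)" if "0 \<le> a" for a b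
    by (rule set_integrable_continuous_inner[OF weak_deriv_integrable[OF wd that] mg cDf])
  have intn: "set_integrable lborel {a..b} (\<lambda>t. norm (g t))" if "0 \<le> a" for a b
    by (intro set_integrable_norm weak_deriv_integrable[OF wd that])
  let ?R = "\<lambda>a b. \<Psi> (f b) - \<Psi> (f a) - (LINT t:{a..b}|lborel. D (f t) \<bullet> g t)"
  \<comment> \<open>One \<open>e\<close> pays for replacing the increment of \<open>\<Psi>\<close>
    by its linearization at \<open>f s\<close>, the other for freezing \<open>D (f t)\<close> at
    \<open>D (f s)\<close> under the integral.\<close>
  have main: "\<bar>?R x y\<bar> \<le> 2 * e * (LINT t:{x..y}|lborel. norm (g t))" if "e > 0" for e
  proof -
    have "0 \<le> x \<longrightarrow> \<bar>?R x y\<bar> \<le> 2 * e * (LINT t:{x..y}|lborel. norm (g t))" using xy(2)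
    proof (induction rule: Bolzano)
      case (trans a b c)
      show ?case
      proof
        assume "0 \<le> a"
        then have b: "0 \<le> b" using trans by simp
        have "?R a c = ?R a b + ?R b c"
          using set_integral_Icc_combine[OF trans(3,4) int[OF \<open>0 \<le> a\<close>]] by simp
        moreover have "(LINT t:{a..c}|lborel. norm (g t)) = (LINT t:{a..b}|lborel. norm (g t)) + (LINT t:{b..c}|lborel. norm (g t))"
          using set_integral_Icc_combine[OF trans(3,4) intn[OF \<open>0 \<le> a\<close>]] by simp
        ultimately show "\<bar>?R a c\<bar> \<le> 2 * e * (LINT t:{a..c}|lborel. norm (g t))"
          using trans(1,2) \<open>0 \<le> a\<close> b by (simp add: algebra_simps)
      qed
    next
      case (local s)
      obtain d where d: "d > 0" "\<And>z. dist z (f s) < d \<Longrightarrow> norm (D z - D (f s)) \<le> e"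
         "\<And>z z'. dist z (f s) < d \<Longrightarrow> dist z' (f s) < d \<Longrightarrow> \<bar>\<Psi> z' - \<Psi> z - D (f s) \<bullet> (z' - z)\<bar> \<le> e * norm (z' - z)"
        using C1_local_linear_bound[OF der cD \<open>e > 0\<close>, of "f s"] by blast
      have "isCont f s" using cf by (simp add: continuous_on_eq_continuous_at)
      then obtain r where r: "r > 0" "\<And>t. dist t s < r \<Longrightarrow> dist (f t) (f s) < d"
        using \<open>d > 0\<close> unfolding continuous_at_eps_delta by blast
      show ?case
      proof (intro exI conjI allI impI)
        show "r > 0" by fact
        fix a b assume ab: "a \<le> s \<and> s \<le> b \<and> b - a < r" and "0 \<le> a"
        have near: "dist (f t) (f s) < d" if "t \<in> {a..b}" for t
          using that ab by (intro r) (auto simp: dist_real_def)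
        have fab: "f b - f a = (LINT t:{a..b}|lborel. g t)"
          by (rule weak_deriv_diff[OF wd]) (use ab \<open>0 \<le> a\<close> in auto)
        have ig: "set_integrable lborel {a..b} g" by (rule weak_deriv_integrable[OF wd \<open>0 \<le> a\<close>])
        have lin: "D (f s) \<bullet> (f b - f a) = (LINT t:{a..b}|lborel. D (f s) \<bullet> g t)"
          unfolding fab set_lebesgue_integral_def using ig unfolding set_integrable_def
          by (subst integral_inner_right[symmetric]) auto
        have ics: "set_integrable lborel {a..b} (\<lambda>t. D (f s) \<bullet> g t)"
          by (rule set_integrable_continuous_inner[OF ig mg]) auto
        have "\<bar>LINT t:{a..b}|lborel. D (f s) \<bullet> g t - D (f t) \<bullet> g t\<bar> \<le> (LINT t:{a..b}|lborel. e * norm (g t))"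
        proof (rule set_integral_abs_bound[where 'a=real, unfolded real_norm_def])
          show "set_integrable lborel {a..b} (\<lambda>t. D (f s) \<bullet> g t - D (f t) \<bullet> g t)"
            using ics int[OF \<open>0 \<le> a\<close>] by (rule set_integral_diff)
          show "set_integrable lborel {a..b} (\<lambda>t. e * norm (g t))"
            using intn[OF \<open>0 \<le> a\<close>] by (rule set_integrable_mult_right)
          fix t assume "t \<in> {a..b}"
          have "\<bar>D (f s) \<bullet> g t - D (f t) \<bullet> g t\<bar> \<le> norm (D (f s) - D (f t)) * norm (g t)"
            by (metis Cauchy_Schwarz_ineq2 inner_diff_left)
          also have "\<dots> \<le> e * norm (g t)"
            using d(2)[OF near[OF \<open>t \<in> {a..b}\<close>]] by (intro mult_right_mono) (auto simp: norm_minus_commute)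
          finally show "\<bar>D (f s) \<bullet> g t - D (f t) \<bullet> g t\<bar> \<le> e * norm (g t)" .
        qed
        then have 1: "\<bar>D (f s) \<bullet> (f b - f a) - (LINT t:{a..b}|lborel. D (f t) \<bullet> g t)\<bar> \<le> e * (LINT t:{a..b}|lborel. norm (g t))"
          unfolding lin using set_integral_diff(2)[OF ics int[OF \<open>0 \<le> a\<close>]] by simp
        have "\<bar>\<Psi> (f b) - \<Psi> (f a) - D (f s) \<bullet> (f b - f a)\<bar> \<le> e * norm (f b - f a)"
          by (rule d) (use near ab in auto)
        also have "\<dots> \<le> e * (LINT t:{a..b}|lborel. norm (g t))"
          unfolding fab using \<open>e > 0\<close> ig by (intro mult_left_mono set_integral_norm_bound) auto
        finally show "\<bar>?R a b\<bar> \<le> 2 * e * (LINT t:{a..b}|lborel. norm (g t))"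
          using 1 by linarith
      qed
    qed
    then show ?thesis using xy(1) by blast
  qed
  let ?C = "LINT t:{x..y}|lborel. norm (g t)"
  have C0: "?C \<ge> 0"
    using set_integral_norm_bound[OF weak_deriv_integrable[OF wd xy(1)], of y] by (rule order_trans[OF norm_ge_zero])
  have "\<bar>?R x y\<bar> \<le> 0 + e" if "e > 0" for e
  proof -
    \<comment> \<open>The \<open>+ 1\<close> keeps the denominator positive when \<open>?C\<close>
      is 0.\<close>
    have "\<bar>?R x y\<bar> \<le> 2 * (e / (2 * (?C + 1))) * ?C"
      using that C0 by (intro main) auto
    also have "\<dots> = e * (?C / (?C + 1))" using C0 by (simp add: field_simps)
    also have "\<dots> \<le> e * 1" using C0 that by (intro mult_left_mono) (auto simp: field_simps)
    finally show ?thesis by simp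
  qed
  then have "\<bar>?R x y\<bar> \<le> 0" by (rule field_le_epsilon)
  then show ?thesis by simp
qed

section \<open>Continuity, measurability and uniqueness for weak derivatives\<close>

lemma weak_deriv_continuous:
  assumes "weak_deriv f g"
  shows "continuous_on {0..} f"
proof -
  have "continuous_on {0..X} f" for X
  proof -
    have i: "set_integrable lborel {0..X} g" by (rule weak_deriv_integrable[OF assms order_refl])
    have "f x = f 0 + integral {0..x} g" if "x \<in> {0..X}" for x :: real
    proof -
      have "f x = f 0 + (LINT t:{0..x}|lborel. g t)"
        using assms that unfolding weak_deriv_def by (meson atLeastAtMost_iff)
      then show ?thesis
        by (simp only: set_borel_integral_eq_integral(2)[OF weak_deriv_integrable[OF assms order_refl]])
    qed
    moreover have "continuous_on {0..X} (\<lambda>x. f 0 + integral {0..x} g)"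
      by (intro continuous_intros indefinite_integral_continuous_1 set_borel_integral_eq_integral(1)[OF i])
    ultimately show ?thesis using continuous_on_cong[OF refl] by (metis (no_types, lifting))
  qed
  then have "continuous (at x within {0..}) f" if "x \<ge> 0" for x
  proof -
    have "continuous (at x within {0..x+1}) f"
      using \<open>\<And>X. continuous_on {0..X} f\<close> that by (auto simp: continuous_on_eq_continuous_within)
    moreover have "at x within {0..x+1} = at x within {0..}"
      by (rule at_within_nhd[where S="{..<x+1}"]) auto
    ultimately show ?thesis by (simp add: continuous_within)
  qed
  then show ?thesis by (simp add: continuous_on_eq_continuous_within)
qed

text \<open>\<open>weak_deriv\<close> gives integrability on bounded intervals only, so
  measurability on the half-line is obtained as a pointwise limit of truncations.\<close>

lemma weak_deriv_measurable:
  assumes "weak_deriv f g"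
  shows "(\<lambda>x. indicator {0..} x *\<^sub>R g x) \<in> borel_measurable borel"
proof (rule borel_measurable_LIMSEQ_metric)
  fix n :: nat
  have "set_integrable lborel {0..real n} g" by (rule weak_deriv_integrable[OF assms order_refl])
  then show "(\<lambda>x. indicator {0..real n} x *\<^sub>R g x) \<in> borel_measurable borel"
    unfolding set_integrable_def by (auto dest: borel_measurable_integrable)
next
  fix x :: real
  obtain m :: nat where m: "x \<le> real m" using real_arch_simple by blast
  have "\<forall>\<^sub>F n in sequentially. indicator {0..real n} x *\<^sub>R g x = indicator {0..} x *\<^sub>R g x"
    using eventually_ge_at_top[of m] by eventually_elim (use m in \<open>auto split: split_indicator\<close>)
  then show "(\<lambda>n. indicator {0..real n} x *\<^sub>R g x) \<longlonglongrightarrow> indicator {0..} x *\<^sub>R g x"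
    by (rule tendsto_eventually)
qed

lemma borel_eq_sigma_sets_atMost: "sets (borel :: real measure) = sigma_sets UNIV (range atMost)"
  unfolding borel_eq_atMost by (simp add: sets_measure_of)

text \<open>A pi-lambda argument: the rays \<open>{..a}\<close> are stable under intersection and
  generate the Borel sets, so vanishing integrals over them propagate to all Borel sets, and then
  the function is 0 almost everywhere. Cutting off at \<open>real n\<close> supplies the global
  integrability needed for complements and countable unions.\<close>

lemma weak_deriv_zero_AE:
  fixes h :: "real \<Rightarrow> complex"
  assumes "\<And>x. 0 \<le> x \<Longrightarrow> set_integrable lborel {0..x} h"
    and "\<And>x. 0 \<le> x \<Longrightarrow> (LINT t:{0..x}|lborel. h t) = (0 :: complex)"
  shows "AE x in lborel. 0 \<le> x \<longrightarrow> h x = 0"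
proof -
  have "AE x in lborel. x \<in> {0..real n} \<longrightarrow> h x = 0" for n :: nat
  proof -
    let ?h = "\<lambda>x. indicator {0..real n} x *\<^sub>R h x"
    have i: "integrable lborel ?h" using assms(1)[of "real n"] unfolding set_integrable_def by simp
    have Iic: "(LINT x:{..a}|lborel. ?h x) = 0" for a
    proof (cases "a \<ge> 0")
      case True
      have "(\<lambda>x. indicator {..a} x *\<^sub>R ?h x) = (\<lambda>x. indicator {0..min a (real n)} x *\<^sub>R h x)"
        by (auto split: split_indicator)
      then show ?thesis using assms(2)[of "min a (real n)"] True
        unfolding set_lebesgue_integral_def by simp
    next
      case False
      then have "(\<lambda>x. indicator {..a} x *\<^sub>R ?h x) = (\<lambda>x. 0)"
        by (auto split: split_indicator)
      then show ?thesis unfolding set_lebesgue_integral_def by simp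
    qed
    have si: "set_integrable lborel A ?h" if "A \<in> sets borel" for A
      unfolding set_integrable_def by (rule integrable_mult_indicator[OF _ i]) (use that in auto)
    have whole: "(LINT x:UNIV|lborel. ?h x) = 0"
      using assms(2)[of "real n"] unfolding set_lebesgue_integral_def by simp
    have "set_lebesgue_integral lborel A ?h = 0" if "A \<in> sets lborel" for A
    proof -
      have "Int_stable (range (atMost :: real \<Rightarrow> _))"
        unfolding Int_stable_def by (auto simp: Int_atMost)
      moreover have "range (atMost :: real \<Rightarrow> _) \<subseteq> Pow UNIV" by simp
      moreover have "A \<in> sigma_sets UNIV (range atMost)"
        using that by (simp add: borel_eq_sigma_sets_atMost)
      ultimately show ?thesis
      proof (induct rule: sigma_sets_induct_disjoint[consumes 3, case_names basic empty compl union])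
        case (basic A) then show ?case using Iic by auto
      next
        case empty then show ?case by (simp add: set_lebesgue_integral_def)
      next
        case (compl A)
        have A: "A \<in> sets borel"
          using compl(1) by (simp add: borel_eq_sigma_sets_atMost)
        have "(LINT x:A \<union> (UNIV - A)|lborel. ?h x) = (LINT x:A|lborel. ?h x) + (LINT x:UNIV - A|lborel. ?h x)"
          by (rule set_integral_Un) (use si A in auto)
        then show ?case using whole compl by simp
      next
        case (union A)
        have A: "A i \<in> sets borel" for i
          using union(2) by (auto simp: borel_eq_sigma_sets_atMost)
        have "(LINT x:(\<Union>i. A i)|lborel. ?h x) = (\<Sum>i. (LINT x:(A i)|lborel. ?h x))"
          by (rule lebesgue_integral_countable_add) (use union A si in \<open>auto simp: disjoint_family_on_def\<close>)
        then show ?case using union by simp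
      qed
    qed
    then have "AE x in lborel. ?h x = 0" by (rule sigma_finite_measure.density_zero[OF sigma_finite_lborel i])
    then show ?thesis by (auto split: split_indicator_asm)
  qed
  then have "AE x in lborel. \<forall>n::nat. x \<in> {0..real n} \<longrightarrow> h x = 0"
    unfolding AE_all_countable by blast
  then show ?thesis
  proof eventually_elim
    case (elim x)
    then show ?case using real_arch_simple[of x] by auto
  qed
qed

text \<open>This makes \<open>dirichlet_half\<close> independent of the derivative picked by its
  \<open>SOME\<close>.\<close>

lemma weak_deriv_unique:
  assumes "weak_deriv f g" "weak_deriv f g'"
  shows "AE x in lborel. 0 \<le> x \<longrightarrow> g x = g' x"
proof -
  have "AE x in lborel. 0 \<le> x \<longrightarrow> g x - g' x = 0"
  proof (rule weak_deriv_zero_AE)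
    fix x :: real assume "0 \<le> x"
    have i: "set_integrable lborel {0..x} g" "set_integrable lborel {0..x} g'"
      using assms by (auto intro: weak_deriv_integrable)
    show "set_integrable lborel {0..x} (\<lambda>x. g x - g' x)" using i by (rule set_integral_diff)
    show "(LINT t:{0..x}|lborel. g t - g' t) = 0"
      using set_integral_diff(2)[OF i] weak_deriv_diff[OF assms(1), of 0 x] weak_deriv_diff[OF assms(2), of 0 x] \<open>0 \<le> x\<close>
      by simp
  qed
  then show ?thesis by simp
qed

section \<open>The edge cost and the Gaussian tail\<close>

text \<open>\<open>gpos r\<close> is the point \<open>b \<ge> 0\<close> with \<open>exp (- b\<^sup>2 / 2) = r\<close> for \<open>0 < r \<le> 1\<close>, and 0 for \<open>r \<ge> 1\<close>.
  The junk value at 0 is harmless, as \<open>gpos\<close> only ever occurs multiplied by its argument there.\<close>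

definition gpos :: "real \<Rightarrow> real" where
  "gpos r = sqrt (max 0 (- ln (r\<^sup>2)))"

text \<open>For \<open>0 \<le> r\<close> this is the square root of the positive part of G. Taking
  the positive part, instead of restricting to the unit disc, makes \<open>drift\<close> and psi
  available on the whole plane, as the chain rule requires.\<close>

definition slope :: "real \<Rightarrow> real" where
  "slope r = r * gpos r"

definition cost :: "real \<Rightarrow> real" where
  "cost r = integral {0..r} slope"

definition drift :: "complex \<Rightarrow> complex" where
  "drift z = gpos (cmod z) *\<^sub>R z"

lemma gpos_nonneg: "0 \<le> gpos r"
  by (simp add: gpos_def)

lemma gpos_exp: "gpos (exp (- (b\<^sup>2) / 2)) = \<bar>b\<bar>"
proof -
  have "(exp (- (b\<^sup>2) / 2))\<^sup>2 = exp (- (b\<^sup>2))"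
    by (simp flip: exp_of_nat_mult)
  then show ?thesis by (simp add: gpos_def)
qed

lemma gpos_square:
  assumes "0 \<le> r" "r \<le> 1"
  shows "(gpos r)\<^sup>2 = - ln (r\<^sup>2)"
proof -
  have "r\<^sup>2 \<le> 1" using assms by (simp add: power_le_one)
  then have "ln (r\<^sup>2) \<le> 0" by (cases "r = 0") auto
  then show ?thesis by (simp add: gpos_def)
qed

lemma exp_gpos:
  assumes "0 < r" "r \<le> 1"
  shows "exp (- ((gpos r)\<^sup>2) / 2) = r"
proof -
  have "ln (r\<^sup>2) = 2 * ln r" using assms by (simp add: ln_realpow)
  then have "- ((gpos r)\<^sup>2) / 2 = ln r" using assms gpos_square[of r] by linarith
  then have "exp (- ((gpos r)\<^sup>2) / 2) = exp (ln r)" by (rule arg_cong)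
  then show ?thesis by (rule trans) (rule exp_ln[OF assms(1)])
qed

text \<open>Follows from ln y < y at y = 1 / |r|. The bound tames the logarithm at 0: it gives
  continuity of \<open>slope\<close> and \<open>drift\<close> there and makes \<open>cost r\<close>
  of order r^(3/2).\<close>

lemma abs_slope_le: "\<bar>slope r\<bar> \<le> sqrt (2 * \<bar>r\<bar>)"
proof (cases "r = 0")
  case False
  have "- ln (r\<^sup>2) = 2 * ln (1 / \<bar>r\<bar>)"
    using False ln_realpow[of "\<bar>r\<bar>" 2] by (simp add: ln_div)
  also have "\<dots> \<le> 2 * (1 / \<bar>r\<bar>)"
    using False by (intro mult_left_mono less_imp_le[OF ln_less_self]) auto
  finally have "max 0 (- ln (r\<^sup>2)) \<le> 2 / \<bar>r\<bar>" by simp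
  then have "r\<^sup>2 * max 0 (- ln (r\<^sup>2)) \<le> r\<^sup>2 * (2 / \<bar>r\<bar>)"
    by (intro mult_left_mono) auto
  also have "\<dots> = 2 * \<bar>r\<bar>" using False by (simp add: power2_eq_square abs_if)
  finally have "sqrt (r\<^sup>2 * max 0 (- ln (r\<^sup>2))) \<le> sqrt (2 * \<bar>r\<bar>)" by simp
  then show ?thesis
    by (simp add: slope_def gpos_def real_sqrt_mult abs_mult)
qed (simp add: slope_def)

lemma norm_drift: "norm (drift z) = slope (cmod z)"
  by (simp add: drift_def slope_def gpos_nonneg)

lemma isCont_gpos: "r \<noteq> 0 \<Longrightarrow> isCont gpos r"
  unfolding gpos_def by (intro continuous_intros) auto

lemma continuous_slope: "continuous_on S slope"
proof -
  have "isCont slope r" for r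
  proof (cases "r = 0")
    case True
    have "(slope \<longlongrightarrow> 0) (at 0)"
    proof (rule Lim_null_comparison)
      show "\<forall>\<^sub>F r in at 0. norm (slope r) \<le> sqrt (2 * \<bar>r\<bar>)" using abs_slope_le by simp
      show "((\<lambda>r::real. sqrt (2 * \<bar>r\<bar>)) \<longlongrightarrow> 0) (at 0)" by (auto intro!: tendsto_eq_intros)
    qed
    then show ?thesis using True by (simp add: isCont_def slope_def)
  next
    case False
    then show ?thesis unfolding slope_def by (intro continuous_intros isCont_gpos)
  qed
  then show ?thesis by (simp add: continuous_at_imp_continuous_on)
qed

lemma continuous_drift: "continuous_on UNIV drift"
proof -
  have "isCont drift z" for z
  proof (cases "z = 0")
    case True
    have "(drift \<longlongrightarrow> 0) (at 0)"
    proof (rule Lim_null_comparison)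
      show "\<forall>\<^sub>F z in at 0. norm (drift z) \<le> sqrt (2 * cmod z)"
        using abs_slope_le[of "cmod _"] by (intro always_eventually allI) (auto simp: norm_drift abs_le_iff)
      show "((\<lambda>z::complex. sqrt (2 * cmod z)) \<longlongrightarrow> 0) (at 0)" by (auto intro!: tendsto_eq_intros)
    qed
    then show ?thesis using True by (simp add: isCont_def drift_def)
  next
    case False
    have "isCont (\<lambda>z. gpos (cmod z)) z"
      by (rule isCont_o2[where g=gpos]) (use False isCont_gpos in auto)
    then show ?thesis unfolding drift_def by (intro continuous_intros)
  qed
  then show ?thesis by (simp add: continuous_at_imp_continuous_on)
qed

lemma cost_0 [simp]: "cost 0 = 0"
  by (simp add: cost_def)

lemma cost_derivative:
  assumes "0 < r"
  shows "(cost has_real_derivative slope r) (at r)"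
proof -
  have "(cost has_real_derivative slope r) (at r within {0..r+1})"
    unfolding cost_def[abs_def]
    by (rule integral_has_real_derivative) (use assms continuous_slope in auto)
  then show ?thesis using assms at_within_interior[of r "{0..r+1}"] by simp
qed

lemma abs_cost_le:
  assumes "0 \<le> r"
  shows "\<bar>cost r\<bar> \<le> sqrt (2 * r) * r"
proof -
  have "norm (integral {0..r} slope) \<le> sqrt (2 * r) * (r - 0)"
  proof (rule integral_bound[OF assms continuous_slope])
    fix t assume "t \<in> {0..r}"
    then have "sqrt (2 * \<bar>t\<bar>) \<le> sqrt (2 * r)" by simp
    then show "norm (slope t) \<le> sqrt (2 * r)"
      unfolding real_norm_def by (rule order_trans[OF abs_slope_le])
  qed
  then show ?thesis by (simp add: cost_def)
qed

lemma cost_less_cost_1: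
  assumes "0 < r" "r < 1"
  shows "cost r < cost 1"
proof (rule DERIV_pos_imp_increasing_open[OF assms(2)])
  fix x assume x: "r < x" "x < 1"
  have "ln (x\<^sup>2) < 0" using x assms by (simp add: ln_realpow)
  then have "slope x > 0" using x assms by (simp add: slope_def gpos_def)
  then show "\<exists>y. DERIV cost x :> y \<and> y > 0" using cost_derivative[of x] x assms by auto
next
  show "continuous_on {r..1} cost"
    using assms by (intro continuous_at_imp_continuous_on ballI DERIV_isCont[OF cost_derivative]) auto
qed

text \<open>At 0 the modulus is not differentiable, but \<open>cost\<close> is O(r^(3/2)) there, so
  the composition has derivative 0, which is \<open>drift 0\<close>. Elsewhere the ordinary chain
  rule applies.\<close>

lemma cost_cmod_derivative: "((\<lambda>z. cost (cmod z)) has_derivative (\<lambda>h. drift z \<bullet> h)) (at z)"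
proof (cases "z = 0")
  case True
  have "((\<lambda>y. norm (cost (cmod y) - cost (cmod 0) - drift 0 \<bullet> (y - 0)) / norm (y - 0)) \<longlongrightarrow> 0) (at 0)"
  proof (rule Lim_null_comparison)
    show "\<forall>\<^sub>F z in at 0. norm (norm (cost (cmod z) - cost (cmod 0) - drift 0 \<bullet> (z - 0)) / norm (z - 0)) \<le> sqrt (2 * cmod z)"
    proof (intro always_eventually allI)
      fix z :: complex
      show "norm (norm (cost (cmod z) - cost (cmod 0) - drift 0 \<bullet> (z - 0)) / norm (z - 0)) \<le> sqrt (2 * cmod z)"
        using abs_cost_le[of "cmod z"] by (cases "z = 0") (auto simp: drift_def field_simps)
    qed
    show "((\<lambda>z::complex. sqrt (2 * cmod z)) \<longlongrightarrow> 0) (at 0)" by (auto intro!: tendsto_eq_intros)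
  qed
  then show ?thesis using True
    by (simp add: has_derivative_iff_norm bounded_linear_inner_right)
next
  case False
  have "((\<lambda>z. cost (cmod z)) has_derivative (\<lambda>h. slope (cmod z) * (sgn z \<bullet> h))) (at z)"
    using has_derivative_compose[OF has_derivative_norm[OF False] cost_derivative[of "cmod z", unfolded has_field_derivative_def]] False
    by (simp add: inner_commute)
  moreover have "(\<lambda>h. slope (cmod z) * (sgn z \<bullet> h)) = (\<lambda>h. drift z \<bullet> h)"
    using False by (auto simp: slope_def drift_def sgn_div_norm)
  ultimately show ?thesis by simp
qed

section \<open>The Gaussian tail, the error function and the threshold\<close>

text \<open>For \<open>0 \<le> b\<close> this is the integral of exp (- t^2) over [b, \<infinity>).
  For negative \<open>b\<close> the interval is empty and the value stays at sqrt pi / 2, so at 0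
  only a one-sided derivative is available.\<close>

definition gtail :: "real \<Rightarrow> real" where
  "gtail b = sqrt pi / 2 - integral {0..b} (\<lambda>t. exp (- (t\<^sup>2)))"

lemma gtail_derivative:
  assumes "0 \<le> b"
  shows "(gtail has_real_derivative - exp (- (b\<^sup>2))) (at b within {0..})"
proof -
  have "((\<lambda>b. integral {0..b} (\<lambda>t. exp (- (t\<^sup>2)))) has_real_derivative exp (- (b\<^sup>2))) (at b within {0..b+1})"
    by (rule integral_has_real_derivative) (use assms in \<open>auto intro!: continuous_intros\<close>)
  moreover have "at b within {0..b+1} = at b within {0..}"
    by (rule at_within_nhd[where S="{..<b+1}"]) auto
  ultimately show ?thesis
    unfolding gtail_def[abs_def] by (auto intro!: derivative_eq_intros)
qed

lemma gtail_tendsto: "(gtail \<longlongrightarrow> 0) at_top"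
proof -
  have i: "set_integrable lborel {0..} (\<lambda>x. exp (- (x\<^sup>2)) :: real)"
    "(LINT x:{0..}|lborel. exp (- (x\<^sup>2)) :: real) = sqrt pi / 2"
    using gaussian_moment_0 unfolding set_integrable_def set_lebesgue_integral_def
    by (auto simp: has_bochner_integral_iff)
  have "((\<lambda>b. LINT x:{0..b}|lborel. exp (- (x\<^sup>2)) :: real) \<longlongrightarrow> sqrt pi / 2) at_top"
    using tendsto_set_lebesgue_integral_at_top[of 0 lborel, OF _ i(1)] i(2) by simp
  moreover have "(LINT x:{0..b}|lborel. exp (- (x\<^sup>2)) :: real) = integral {0..b} (\<lambda>x. exp (- (x\<^sup>2)))" for b
    by (intro set_borel_integral_eq_integral set_integrable_subset[OF i(1)]) auto
  ultimately have "((\<lambda>b. integral {0..b} (\<lambda>x. exp (- (x\<^sup>2)) :: real)) \<longlongrightarrow> sqrt pi / 2) at_top"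
    by simp
  from tendsto_diff[OF tendsto_const[of "sqrt pi / 2"] this] show ?thesis
    unfolding gtail_def[abs_def] by simp
qed

lemma cost_tendsto_0:
  assumes "(f \<longlongrightarrow> 0) F" "\<And>x. 0 \<le> f x"
  shows "((\<lambda>x. cost (f x)) \<longlongrightarrow> 0) F"
proof (rule Lim_null_comparison)
  show "\<forall>\<^sub>F x in F. norm (cost (f x)) \<le> sqrt (2 * f x) * f x"
    using abs_cost_le assms(2) by simp
  show "((\<lambda>x. sqrt (2 * f x) * f x) \<longlongrightarrow> 0) F"
    using assms(1) by (auto intro!: tendsto_eq_intros)
qed

text \<open>In the parameter \<open>b\<close> both sides have derivative - 2 b^2 exp (- b^2), and
  both tend to 0 at infinity. The first summand is the part that the vertex term will cancel; the
  tail is what survives.\<close>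

lemma cost_exp:
  assumes "0 \<le> b"
  shows "2 * cost (exp (- (b\<^sup>2) / 2)) = b * exp (- (b\<^sup>2)) + gtail b"
proof -
  let ?K = "\<lambda>b. 2 * cost (exp (- (b\<^sup>2) / 2)) - b * exp (- (b\<^sup>2)) - gtail b"
  have sq: "exp (- (b\<^sup>2) / 2) * exp (- (b\<^sup>2) / 2) = exp (- (b\<^sup>2))" for b :: real
    by (simp flip: exp_add)
  have "\<exists>c. \<forall>b\<in>{0..}. ?K b = c"
  proof (rule has_field_derivative_zero_constant)
    fix b :: real assume b: "b \<in> {0..}"
    have "((\<lambda>b. exp (- (b\<^sup>2) / 2)) has_real_derivative - b * exp (- (b\<^sup>2) / 2)) (at b within {0..})"
      by (auto intro!: derivative_eq_intros)
    from DERIV_chain2[OF cost_derivative this]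
    have "((\<lambda>b. cost (exp (- (b\<^sup>2) / 2))) has_real_derivative
        slope (exp (- (b\<^sup>2) / 2)) * (- b * exp (- (b\<^sup>2) / 2))) (at b within {0..})"
      by simp
    moreover have "slope (exp (- (b\<^sup>2) / 2)) * (- b * exp (- (b\<^sup>2) / 2)) = - (b\<^sup>2) * exp (- (b\<^sup>2))"
      using b unfolding slope_def gpos_exp sq[symmetric] by (simp add: power2_eq_square)
    ultimately have d: "((\<lambda>b. cost (exp (- (b\<^sup>2) / 2))) has_real_derivative - (b\<^sup>2) * exp (- (b\<^sup>2))) (at b within {0..})"
      by simp
    show "(?K has_real_derivative 0) (at b within {0..})"
      by (rule derivative_eq_intros d gtail_derivative refl)+
        (use b in \<open>auto simp: algebra_simps power2_eq_square\<close>)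
  qed auto
  then obtain c where c: "\<And>b. 0 \<le> b \<Longrightarrow> ?K b = c" by auto
  have "((\<lambda>b::real. exp (- (b\<^sup>2) / 2)) \<longlongrightarrow> 0) at_top" by real_asymp
  moreover have "((\<lambda>b::real. b * exp (- (b\<^sup>2))) \<longlongrightarrow> 0) at_top" by real_asymp
  ultimately have "(?K \<longlongrightarrow> 2 * 0 - 0 - 0) at_top"
    by (intro tendsto_intros cost_tendsto_0 gtail_tendsto) auto
  moreover have "(?K \<longlongrightarrow> c) at_top"
    by (rule tendsto_eventually, rule eventually_mono[OF eventually_ge_at_top c])
  ultimately have "2 * 0 - 0 - 0 = c" by (rule tendsto_unique[OF trivial_limit_at_top_linorder])
  then show ?thesis using c[OF assms] by simp
qed

text \<open>The left side is what a profile on the line pays for rising from 0 to height 1 and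
  descending again.\<close>

lemma cost_1: "4 * cost 1 = sqrt pi"
  using cost_exp[of 0] by (simp add: gtail_def)

lemma gtail_antimono:
  assumes "0 \<le> a" "a \<le> b"
  shows "gtail b \<le> gtail a"
proof -
  have i: "(\<lambda>t::real. exp (- (t\<^sup>2))) integrable_on {x..y}" for x y
    by (intro integrable_continuous_interval continuous_intros)
  have "0 \<le> integral {a..b} (\<lambda>t::real. exp (- (t\<^sup>2)))" by (intro integral_nonneg i) auto
  then show ?thesis
    unfolding gtail_def using Henstock_Kurzweil_Integration.integral_combine[OF assms i] by simp
qed

lemma gtail_nonneg:
  assumes "0 \<le> b"
  shows "0 \<le> gtail b"
proof (rule tendsto_upperbound[OF gtail_tendsto])
  show "\<forall>\<^sub>F x in at_top. gtail x \<le> gtail b"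
    using eventually_ge_at_top[of b] by eventually_elim (rule gtail_antimono[OF assms])
qed simp

lemma erf_eq_gtail: "erf b = 1 - 2 / sqrt pi * gtail b"
  by (simp add: erf_def gtail_def field_simps)

lemma gtail_strict_antimono:
  assumes "0 \<le> a" "a < b"
  shows "gtail b < gtail a"
proof (rule DERIV_neg_imp_decreasing_open[OF assms(2)])
  fix x assume x: "a < x" "x < b"
  have "(gtail has_real_derivative - exp (- (x\<^sup>2))) (at x)"
    using gtail_derivative[of x] x assms at_within_interior[of x "{0..}"] by simp
  then show "\<exists>y. DERIV gtail x :> y \<and> y < 0" by (intro exI[of _ "- exp (- (x\<^sup>2))"]) auto
next
  show "continuous_on {a..b} gtail"
    by (rule continuous_on_subset[OF DERIV_continuous_on[OF gtail_derivative]]) (use assms in auto)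
qed

lemma gtail_pos: "0 \<le> b \<Longrightarrow> 0 < gtail b"
  using gtail_strict_antimono[of b "b + 1"] gtail_nonneg[of "b + 1"] by simp

lemma erf_strict_mono:
  assumes "0 \<le> a" "a < b"
  shows "erf a < erf b"
  using gtail_strict_antimono[OF assms] by (simp add: erf_eq_gtail divide_strict_right_mono)

lemma erf_inv_props:
  assumes "0 \<le> y" "y < 1"
  shows "0 \<le> erf_inv y \<and> erf (erf_inv y) = y"
proof -
  have "((\<lambda>x. erf x) \<longlongrightarrow> 1 - 2 / sqrt pi * 0) at_top"
    unfolding erf_eq_gtail by (intro tendsto_intros gtail_tendsto)
  then have "\<forall>\<^sub>F x in at_top. y < erf x" using assms by (intro order_tendstoD) auto
  then obtain X where X: "\<And>x. x \<ge> X \<Longrightarrow> y < erf x" by (auto simp: eventually_at_top_linorder)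
  define Z where "Z = max X 0"
  have "continuous_on {0..Z} erf"
    unfolding erf_eq_gtail[abs_def]
    by (intro continuous_intros continuous_on_subset[OF DERIV_continuous_on[OF gtail_derivative]]) auto
  moreover have "erf 0 \<le> y" using assms by (simp add: erf_def)
  moreover have "y \<le> erf Z" "0 \<le> Z" using X[of Z] by (auto simp: Z_def)
  ultimately obtain s where s: "0 \<le> s" "erf s = y" using IVT'[of erf 0 y Z] by auto
  have "t = s" if "0 \<le> t \<and> erf t = y" for t
    using that s erf_strict_mono[of s t] erf_strict_mono[of t s] by (cases s t rule: linorder_cases) auto
  then have "\<exists>!s. 0 \<le> s \<and> erf s = y" using s by blast
  then show ?thesis unfolding erf_inv_def by (rule theI')
qed

text \<open>With a = \<gamma> / N, the inequality erf a > 1 - 2 / N is the same as N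
  \<open>gtail a\<close> < sqrt pi. The threshold enters the estimates only in this form, together
  with positivity of a.\<close>

lemma gamma_star_less:
  assumes N: "N \<ge> 2" and g: "\<gamma> > gamma_star N"
  shows "0 < \<gamma> / real N" "real N * gtail (\<gamma> / real N) < sqrt pi"
proof -
  let ?y = "1 - 2 / real N"
  have e: "0 \<le> erf_inv ?y \<and> erf (erf_inv ?y) = ?y"
    using N by (intro erf_inv_props) auto
  have l: "erf_inv ?y < \<gamma> / real N"
    using g N by (simp add: gamma_star_def pos_less_divide_eq mult.commute)
  then show "0 < \<gamma> / real N" using e by linarith
  have "?y < erf (\<gamma> / real N)" using erf_strict_mono[of "erf_inv ?y", OF _ l] e by simp
  then have "2 / sqrt pi * gtail (\<gamma> / real N) < 2 / real N" by (simp add: erf_eq_gtail)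
  then show "real N * gtail (\<gamma> / real N) < sqrt pi" using N by (simp add: field_simps)
qed

text \<open>The right-hand side of the conclusion is the least energy of a profile that starts at height \<^term>\<open>c\<close> at
  the vertex and climbs to the height 1 on one edge. As a function of \<^term>\<open>gpos c\<close> it first increases and then
  decreases, so only the two extreme values of \<^term>\<open>c\<close> matter.\<close>

lemma climbing_cost:
  assumes N: "N \<ge> 2" and a: "0 < a" and E: "real N * gtail a < sqrt pi"
    and c: "0 \<le> c" "c \<le> exp (- (a\<^sup>2) / 2)"
  shows "real N * gtail a < 2 * (real N - 2) * cost c + 4 * cost 1 - real N * a * c\<^sup>2"
proof (cases "c = 0")
  case True
  \<comment> \<open>Height 0 has no parameter \<open>gpos c\<close>; here the right-hand side is
    exactly sqrt pi, so the threshold inequality itself is the claim.\<close>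
  then show ?thesis using E cost_1 by simp
next
  case False
  have c1: "c < 1" using c a by (meson exp_less_one_iff divide_neg_pos le_less_trans neg_less_0_iff_less zero_less_numeral zero_less_power)
  define b where "b = gpos c"
  have b0: "0 \<le> b" by (simp add: b_def gpos_nonneg)
  have cb: "c = exp (- (b\<^sup>2) / 2)" using exp_gpos[of c] False c c1 by (simp add: b_def)
  have c2: "c\<^sup>2 = exp (- (b\<^sup>2))" unfolding cb by (simp flip: exp_of_nat_mult)
  have ab: "a \<le> b"
  proof -
    have "a\<^sup>2 \<le> b\<^sup>2" using c(2) unfolding cb by simp
    then show ?thesis using b0 by (rule power2_le_imp_le)
  qed
  \<comment> \<open>The right-hand side in the parameter b of \<open>c\<close>. Its derivative is 2
    b exp (- b^2) (N a - (N - 2) b), whose last factor decides the case distinction below.\<close>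
  let ?F = "\<lambda>b. (real N - 2) * (b * exp (- (b\<^sup>2)) + gtail b) + sqrt pi - real N * a * exp (- (b\<^sup>2))"
  have eq: "2 * (real N - 2) * cost c + 4 * cost 1 - real N * a * c\<^sup>2 = ?F b"
    using cost_exp[OF b0] unfolding cb[symmetric] c2 cost_1 by (simp add: algebra_simps)
  show ?thesis
  proof (cases "real N * a < (real N - 2) * b")
    case True
    \<comment> \<open>Past the critical point the edge term outweighs the vertex term, so
      \<open>?F b\<close> is at least sqrt pi, its limit at infinity.\<close>
    then have "real N * a * exp (- (b\<^sup>2)) \<le> (real N - 2) * b * exp (- (b\<^sup>2))"
      by (intro mult_right_mono) auto
    moreover have "0 \<le> (real N - 2) * gtail b" using N gtail_nonneg[OF b0] by simp
    ultimately have "sqrt pi \<le> ?F b" by (simp add: algebra_simps)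
    then show ?thesis using E eq by simp
  next
    case False
    have "?F a \<le> ?F b"
    proof (rule DERIV_nonneg_imp_nondecreasing[OF ab])
      fix x assume x: "a \<le> x" "x \<le> b"
      have d: "(gtail has_real_derivative - exp (- (x\<^sup>2))) (at x)"
        using gtail_derivative[of x] x a at_within_interior[of x "{0..}"] by simp
      have "(?F has_real_derivative 2 * x * exp (- (x\<^sup>2)) * (real N * a - (real N - 2) * x)) (at x)"
        by (auto intro!: derivative_eq_intros d simp: algebra_simps power2_eq_square)
      moreover have "0 \<le> 2 * x * exp (- (x\<^sup>2)) * (real N * a - (real N - 2) * x)"
      proof -
        have "(real N - 2) * x \<le> (real N - 2) * b" using x N by (intro mult_left_mono) auto
        then show ?thesis using False x a by simp
      qed
      ultimately show "\<exists>y. DERIV ?F x :> y \<and> 0 \<le> y" by blast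
    qed
    \<comment> \<open>The gap is 4 (\<open>cost 1\<close> - \<open>cost h\<close>) with h = exp (-
      a^2 / 2), the price of the detour from the vertex height up to 1 and back.\<close>
    moreover have "real N * gtail a < ?F a"
    proof -
      have "exp (- (a\<^sup>2) / 2) < 1" using a by simp
      then have "2 * cost (exp (- (a\<^sup>2) / 2)) < 2 * cost 1" using cost_less_cost_1 by simp
      then have "2 * (a * exp (- (a\<^sup>2)) + gtail a) < sqrt pi" using cost_exp[of a] cost_1 a by simp
      then show ?thesis by (simp add: algebra_simps)
    qed
    ultimately show ?thesis using eq by simp
  qed
qed

section \<open>Energy on one edge\<close>

lemma set_integral_Ici_combine:
  fixes h :: "real \<Rightarrow> 'a::{banach, second_countable_topology}"
  assumes "a \<le> b" "set_integrable lborel {a..} h"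
  shows "(LINT x:{a..}|lborel. h x) = (LINT x:{a..b}|lborel. h x) + (LINT x:{b..}|lborel. h x)"
proof -
  have i: "set_integrable lborel {a..b} h" "set_integrable lborel {b<..} h"
    using assms by (auto intro: set_integrable_subset)
  have "{a..} = {a..b} \<union> {b<..}" "{a..b} \<inter> {b<..} = {}" using assms by auto
  then have "(LINT x:{a..}|lborel. h x) = (LINT x:{a..b}|lborel. h x) + (LINT x:{b<..}|lborel. h x)"
    using set_integral_Un[OF _ i] by simp
  also have "(LINT x:{b<..}|lborel. h x) = (LINT x:{b..}|lborel. h x)"
    by (rule set_integral_discrete_difference[where X="{b}"]) auto
  finally show ?thesis .
qed

text \<open>If \<open>L\<close> were positive, the windows [b, b + 1] would eventually contribute at
  least \<open>L / 2\<close> each, although their integrals tend to 0 by convergence of the whole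
  integral.\<close>

lemma integrable_limit_zero:
  fixes \<phi> :: "real \<Rightarrow> real"
  assumes i: "set_integrable lborel {0..} \<phi>" and lim: "(\<phi> \<longlongrightarrow> L) at_top" and nn: "\<And>x. 0 \<le> \<phi> x"
  shows "L = 0"
proof (rule ccontr)
  assume "L \<noteq> 0"
  moreover have "0 \<le> L" by (rule tendsto_lowerbound[OF lim]) (auto simp: nn)
  ultimately have L: "0 < L / 2" "L / 2 < L" by auto
  obtain X where X: "\<And>x. x \<ge> X \<Longrightarrow> L / 2 < \<phi> x"
    using order_tendstoD(1)[OF lim L(2)] by (auto simp: eventually_at_top_linorder)
  let ?I = "\<lambda>b. LINT x:{0..b}|lborel. \<phi> x"
  have T: "(?I \<longlongrightarrow> (LINT x:{0..}|lborel. \<phi> x)) at_top"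
    by (rule tendsto_set_lebesgue_integral_at_top[OF _ i]) auto
  have "((\<lambda>b. ?I (b + 1)) \<longlongrightarrow> (LINT x:{0..}|lborel. \<phi> x)) at_top"
    by (rule filterlim_compose[OF T]) real_asymp
  from tendsto_diff[OF this T] have D: "((\<lambda>b. ?I (b + 1) - ?I b) \<longlongrightarrow> 0) at_top" by simp
  have "\<forall>\<^sub>F b in at_top. L / 2 \<le> ?I (b + 1) - ?I b"
    using eventually_ge_at_top[of "max X 0"]
  proof eventually_elim
    case (elim b)
    have s: "set_integrable lborel {b..b+1} \<phi>" "set_integrable lborel {0..b+1} \<phi>"
      by (rule set_integrable_subset[OF i]; use elim in auto)+
    have "?I (b + 1) - ?I b = (LINT x:{b..b+1}|lborel. \<phi> x)"
      using set_integral_Icc_combine[OF _ _ s(2), of b] elim by simp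
    also have "\<dots> \<ge> (LINT x:{b..b+1}|lborel. L / 2)"
    proof (rule set_integral_mono)
      show "set_integrable lborel {b..b+1} (\<lambda>x. L / 2)"
        by (intro borel_integrable_atLeastAtMost') auto
      show "L / 2 \<le> \<phi> x" if "x \<in> {b..b+1}" for x using X[of x] that elim by auto
    qed (use s in auto)
    also have "(LINT x:{b..b+1}|lborel. L / 2) = L / 2"
      by (simp add: set_lebesgue_integral_def)
    finally show ?case .
  qed
  then have "L / 2 \<le> 0" by (intro tendsto_lowerbound[OF D]) auto
  then show False using L by simp
qed

text \<open>Twice the contribution of one edge to the action at \<omega> = - 1, where the mass term
  drops out; the vertex term is kept apart.\<close>

definition energy :: "(real \<Rightarrow> complex) \<Rightarrow> (real \<Rightarrow> complex) \<Rightarrow> real" where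
  "energy f g = (LINT x:{0..}|lborel. (cmod (g x))\<^sup>2) - (LINT x:{0..}|lborel. (cmod (f x))\<^sup>2 * ln ((cmod (f x))\<^sup>2))"

definition mass :: "(real \<Rightarrow> complex) \<Rightarrow> real" where
  "mass f = (LINT x:{0..}|lborel. (cmod (f x))\<^sup>2)"

text \<open>Extending \<^term>\<open>f\<close> and \<^term>\<open>g\<close> suitably to the negative reals makes continuity and measurability
  hold on the whole line.\<close>

locale half_line_fun =
  fixes f g :: "real \<Rightarrow> complex"
  assumes weak_deriv: "weak_deriv f g"
    and cont: "continuous_on UNIV f"
    and meas: "g \<in> borel_measurable borel"
    and L2f: "set_integrable lborel {0..} (\<lambda>x. (cmod (f x))\<^sup>2)"
    and L2g: "set_integrable lborel {0..} (\<lambda>x. (cmod (g x))\<^sup>2)"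
    and ent: "set_integrable lborel {0..} (\<lambda>x. (cmod (f x))\<^sup>2 * ln ((cmod (f x))\<^sup>2))"
begin

lemma measf [measurable]: "f \<in> borel_measurable borel"
  using cont by (rule borel_measurable_continuous_onI)

declare meas [measurable]

lemma inner_integrable:
  assumes "continuous_on UNIV h" and "set_integrable lborel {0..} (\<lambda>x. (cmod (h x))\<^sup>2)"
  shows "set_integrable lborel {0..} (\<lambda>x. h x \<bullet> g x)"
proof (rule set_integrable_bound)
  have [measurable]: "h \<in> borel_measurable borel"
    using assms(1) by (rule borel_measurable_continuous_onI)
  show "set_integrable lborel {0..} (\<lambda>x. (cmod (h x))\<^sup>2 + (cmod (g x))\<^sup>2)"
    using assms(2) L2g by (rule set_integral_add)
  show "set_borel_measurable lborel {0..} (\<lambda>x. h x \<bullet> g x)"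
    unfolding set_borel_measurable_def by measurable
  have "norm (h x \<bullet> g x) \<le> norm ((cmod (h x))\<^sup>2 + (cmod (g x))\<^sup>2)" for x
  proof -
    have "\<bar>h x \<bullet> g x\<bar> \<le> cmod (h x) * cmod (g x)" by (rule Cauchy_Schwarz_ineq2)
    moreover have "0 \<le> (cmod (h x) - cmod (g x))\<^sup>2" by simp
    moreover have "0 \<le> cmod (h x) * cmod (g x)" by simp
    ultimately show ?thesis by (simp add: power2_diff)
  qed
  then show "AE x in lborel. x \<in> {0..} \<longrightarrow> norm (h x \<bullet> g x) \<le> norm ((cmod (h x))\<^sup>2 + (cmod (g x))\<^sup>2)"
    by simp
qed

text \<open>By the chain rule |f|^2 has the integrable derivative 2 (f \<bullet> g), so it converges
  at infinity; its own integrability forces the limit to be 0.\<close>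

lemma tendsto_zero: "((\<lambda>x. cmod (f x)) \<longlongrightarrow> 0) at_top"
proof -
  have c2: "continuous_on UNIV (\<lambda>x. 2 *\<^sub>R f x)" by (intro continuous_intros cont)
  have i2: "set_integrable lborel {0..} (\<lambda>x. (cmod (2 *\<^sub>R f x))\<^sup>2)"
    using set_integrable_mult_right[OF L2f, of 4] by (simp add: power_mult_distrib)
  have ch: "f x \<bullet> f x - f 0 \<bullet> f 0 = (LINT t:{0..x}|lborel. (2 *\<^sub>R f t) \<bullet> g t)" if "0 \<le> x" for x
    by (rule weak_deriv_chain_rule[OF weak_deriv cont meas _ _ order_refl that, where D="\<lambda>z. 2 *\<^sub>R z"])
      (auto intro!: derivative_eq_intros continuous_intros simp: inner_commute)
  have "((\<lambda>x. f 0 \<bullet> f 0 + (LINT t:{0..x}|lborel. (2 *\<^sub>R f t) \<bullet> g t)) \<longlongrightarrow>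
      f 0 \<bullet> f 0 + (LINT t:{0..}|lborel. (2 *\<^sub>R f t) \<bullet> g t)) at_top"
    by (intro tendsto_add tendsto_const tendsto_set_lebesgue_integral_at_top inner_integrable[OF c2 i2]) auto
  moreover have "\<forall>\<^sub>F x in at_top. f 0 \<bullet> f 0 + (LINT t:{0..x}|lborel. (2 *\<^sub>R f t) \<bullet> g t) = (cmod (f x))\<^sup>2"
    using eventually_ge_at_top[of 0]
  proof eventually_elim
    case (elim x)
    then show ?case using ch[OF elim] unfolding power2_norm_eq_inner by linarith
  qed
  ultimately have lim: "((\<lambda>x. (cmod (f x))\<^sup>2) \<longlongrightarrow> f 0 \<bullet> f 0 + (LINT t:{0..}|lborel. (2 *\<^sub>R f t) \<bullet> g t)) at_top"
    by (rule Lim_transform_eventually)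
  have "((\<lambda>x. (cmod (f x))\<^sup>2) \<longlongrightarrow> 0) at_top"
    using lim[unfolded integrable_limit_zero[OF L2f lim zero_le_power2]] .
  from tendsto_real_sqrt[OF this] show ?thesis by simp
qed

lemma sup_attained: "\<exists>x\<ge>0. \<forall>y\<ge>0. cmod (f y) \<le> cmod (f x)"
proof (cases "\<exists>x\<ge>0. f x \<noteq> 0")
  case True
  then obtain x0 where x0: "x0 \<ge> 0" "cmod (f x0) > 0" by auto
  obtain X where X: "\<And>x. x \<ge> X \<Longrightarrow> cmod (f x) < cmod (f x0)"
    using order_tendstoD(2)[OF tendsto_zero x0(2)] by (auto simp: eventually_at_top_linorder)
  define Y where "Y = max X x0"
  have "continuous_on {0..Y} (\<lambda>x. cmod (f x))"
    by (intro continuous_intros continuous_on_subset[OF cont]) auto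
  moreover have "{0..Y} \<noteq> {}" using x0 by (auto simp: Y_def)
  ultimately obtain x where x: "x \<in> {0..Y}" "\<And>y. y \<in> {0..Y} \<Longrightarrow> cmod (f y) \<le> cmod (f x)"
    using continuous_attains_sup[of "{0..Y}" "\<lambda>x. cmod (f x)"] by auto
  have "cmod (f y) \<le> cmod (f x)" if "y \<ge> 0" for y
  proof (cases "y \<le> Y")
    case False
    then have "cmod (f y) < cmod (f x0)" by (intro X) (auto simp: Y_def)
    also have "\<dots> \<le> cmod (f x)" by (rule x) (use x0 in \<open>auto simp: Y_def\<close>)
    finally show ?thesis by simp
  qed (use x that in auto)
  then show ?thesis using x by auto
qed (auto intro!: exI[of _ 0])

lemma mass_nonneg: "0 \<le> mass f"
  unfolding mass_def set_lebesgue_integral_def by (intro Bochner_Integration.integral_nonneg) simp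

text \<open>The logarithm turns a change of amplitude into an additive multiple of the mass. This
  law serves twice: to remove \<omega>, and to follow the energy along a ray.\<close>

lemma scale:
  assumes "l > 0"
  shows "half_line_fun (\<lambda>x. l *\<^sub>R f x) (\<lambda>x. l *\<^sub>R g x)"
    and "mass (\<lambda>x. l *\<^sub>R f x) = l\<^sup>2 * mass f"
    and "energy (\<lambda>x. l *\<^sub>R f x) (\<lambda>x. l *\<^sub>R g x) = l\<^sup>2 * (energy f g - ln (l\<^sup>2) * mass f)"
proof -
  have sq: "(cmod (l *\<^sub>R z))\<^sup>2 = l\<^sup>2 * (cmod z)\<^sup>2" for z
    by (simp add: power_mult_distrib)
  have en: "(cmod (l *\<^sub>R z))\<^sup>2 * ln ((cmod (l *\<^sub>R z))\<^sup>2) =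
      l\<^sup>2 * ((cmod z)\<^sup>2 * ln ((cmod z)\<^sup>2) + ln (l\<^sup>2) * (cmod z)\<^sup>2)" for z
    unfolding sq using assms by (cases "z = 0") (simp_all add: ln_mult algebra_simps)
  have i: "set_integrable lborel {0..} (\<lambda>x. (cmod (f x))\<^sup>2 * ln ((cmod (f x))\<^sup>2) + ln (l\<^sup>2) * (cmod (f x))\<^sup>2)"
    by (intro set_integral_add ent set_integrable_mult_right L2f)
  show "half_line_fun (\<lambda>x. l *\<^sub>R f x) (\<lambda>x. l *\<^sub>R g x)"
  proof
    show "weak_deriv (\<lambda>x. l *\<^sub>R f x) (\<lambda>x. l *\<^sub>R g x)"
      unfolding weak_deriv_def
    proof (intro allI impI conjI)
      fix x :: real assume x: "0 \<le> x"
      show "set_integrable lborel {0..x} (\<lambda>x. l *\<^sub>R g x)"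
        by (intro set_integrable_scaleR_right weak_deriv_integrable[OF weak_deriv]) auto
      have "f x = f 0 + (LINT t:{0..x}|lborel. g t)"
        using weak_deriv_diff[OF weak_deriv order_refl x] by (simp add: algebra_simps)
      then have "l *\<^sub>R f x = l *\<^sub>R (f 0 + (LINT t:{0..x}|lborel. g t))" by (rule arg_cong)
      then show "l *\<^sub>R f x = l *\<^sub>R f 0 + (LINT t:{0..x}|lborel. l *\<^sub>R g t)"
        by (simp only: set_integral_scaleR_right scaleR_add_right)
    qed
    show "continuous_on UNIV (\<lambda>x. l *\<^sub>R f x)" by (intro continuous_intros cont)
    show "(\<lambda>x. l *\<^sub>R g x) \<in> borel_measurable borel" by measurable
    show "set_integrable lborel {0..} (\<lambda>x. (cmod (l *\<^sub>R f x))\<^sup>2)"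
      "set_integrable lborel {0..} (\<lambda>x. (cmod (l *\<^sub>R g x))\<^sup>2)"
      unfolding sq by (intro set_integrable_mult_right L2f L2g)+
    show "set_integrable lborel {0..} (\<lambda>x. (cmod (l *\<^sub>R f x))\<^sup>2 * ln ((cmod (l *\<^sub>R f x))\<^sup>2))"
      unfolding en by (intro set_integrable_mult_right i)
  qed
  show "mass (\<lambda>x. l *\<^sub>R f x) = l\<^sup>2 * mass f"
    unfolding mass_def sq by (rule set_integral_mult_right)
  have "(LINT x:{0..}|lborel. (cmod (l *\<^sub>R f x))\<^sup>2 * ln ((cmod (l *\<^sub>R f x))\<^sup>2)) =
     l\<^sup>2 * ((LINT x:{0..}|lborel. (cmod (f x))\<^sup>2 * ln ((cmod (f x))\<^sup>2)) + ln (l\<^sup>2) * mass f)"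
    unfolding en set_integral_mult_right mass_def
    using set_integral_add(2)[OF ent set_integrable_mult_right[OF L2f]] by simp
  then show "energy (\<lambda>x. l *\<^sub>R f x) (\<lambda>x. l *\<^sub>R g x) = l\<^sup>2 * (energy f g - ln (l\<^sup>2) * mass f)"
    unfolding energy_def sq set_integral_mult_right by (simp add: algebra_simps)
qed

end

section \<open>Profiles of height at most 1: completing the square\<close>

text \<open>Up to height 1 the density - |f|^2 ln(|f|^2) is nonnegative and equals
  |\<open>drift\<close> f|^2. Above it the density is negative while \<open>drift\<close> vanishes,
  and the identity fails.\<close>

locale unit_half_line_fun = half_line_fun +
  assumes le_1: "0 \<le> x \<Longrightarrow> cmod (f x) \<le> 1"
begin

lemma norm_drift_square: "0 \<le> x \<Longrightarrow> (cmod (drift (f x)))\<^sup>2 = - ((cmod (f x))\<^sup>2 * ln ((cmod (f x))\<^sup>2))"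
  unfolding norm_drift slope_def power_mult_distrib using gpos_square[OF _ le_1] by simp

lemma drift_square_integrable: "set_integrable lborel {0..} (\<lambda>x. (cmod (drift (f x)))\<^sup>2)"
proof -
  have "set_integrable lborel {0..} (\<lambda>x. (cmod (drift (f x)))\<^sup>2) \<longleftrightarrow>
    set_integrable lborel {0..} (\<lambda>x. - 1 * ((cmod (f x))\<^sup>2 * ln ((cmod (f x))\<^sup>2)))"
    by (rule set_integrable_cong) (use norm_drift_square in auto)
  then show ?thesis using set_integrable_mult_right[OF ent, of "- 1"] by simp
qed

lemma energy_eq: "energy f g = (LINT x:{0..}|lborel. (cmod (g x))\<^sup>2 + (cmod (drift (f x)))\<^sup>2)"
proof -
  have "(LINT x:{0..}|lborel. (cmod (drift (f x)))\<^sup>2) = (LINT x:{0..}|lborel. - 1 * ((cmod (f x))\<^sup>2 * ln ((cmod (f x))\<^sup>2)))"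
    by (rule set_lebesgue_integral_cong) (use norm_drift_square in auto)
  also have "\<dots> = - (LINT x:{0..}|lborel. (cmod (f x))\<^sup>2 * ln ((cmod (f x))\<^sup>2))"
    unfolding set_integral_mult_right by simp
  finally show ?thesis
    unfolding energy_def using set_integral_add(2)[OF L2g drift_square_integrable] by simp
qed

lemma continuous_drift_f: "continuous_on UNIV (\<lambda>x. drift (f x))"
  using continuous_on_compose2[OF continuous_drift cont] by auto

lemma drift_inner_integrable: "set_integrable lborel {0..} (\<lambda>x. drift (f x) \<bullet> g x)"
  by (rule inner_integrable[OF continuous_drift_f drift_square_integrable])

lemma drift_inner_Icc:
  assumes "0 \<le> x" "x \<le> y"
  shows "(LINT t:{x..y}|lborel. drift (f t) \<bullet> g t) = cost (cmod (f y)) - cost (cmod (f x))"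
  by (rule weak_deriv_chain_rule[OF weak_deriv cont meas cost_cmod_derivative continuous_drift assms, symmetric])

lemma drift_inner_Ici:
  assumes "0 \<le> x"
  shows "(LINT t:{x..}|lborel. drift (f t) \<bullet> g t) = - cost (cmod (f x))"
proof (rule tendsto_unique[OF trivial_limit_at_top_linorder])
  have "set_integrable lborel {x..} (\<lambda>t. drift (f t) \<bullet> g t)"
    by (rule set_integrable_subset[OF drift_inner_integrable]) (use assms in auto)
  then show "((\<lambda>y. LINT t:{x..y}|lborel. drift (f t) \<bullet> g t) \<longlongrightarrow> (LINT t:{x..}|lborel. drift (f t) \<bullet> g t)) at_top"
    by (intro tendsto_set_lebesgue_integral_at_top) auto
  have "((\<lambda>y. cost (cmod (f y)) - cost (cmod (f x))) \<longlongrightarrow> 0 - cost (cmod (f x))) at_top"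
    by (intro tendsto_intros cost_tendsto_0 tendsto_zero) auto
  then have "((\<lambda>y. LINT t:{x..y}|lborel. drift (f t) \<bullet> g t) \<longlongrightarrow> 0 - cost (cmod (f x))) at_top"
  proof (rule Lim_transform_eventually)
    show "\<forall>\<^sub>F y in at_top. cost (cmod (f y)) - cost (cmod (f x)) = (LINT t:{x..y}|lborel. drift (f t) \<bullet> g t)"
      using eventually_ge_at_top[of x] by eventually_elim (rule drift_inner_Icc[OF assms, symmetric])
  qed
  then show "((\<lambda>y. LINT t:{x..y}|lborel. drift (f t) \<bullet> g t) \<longlongrightarrow> - cost (cmod (f x))) at_top"
    by simp
qed

lemma energy_square_completed:
  "energy f g = 2 * cost (cmod (f 0)) + (LINT x:{0..}|lborel. (cmod (g x + drift (f x)))\<^sup>2)"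
  "set_integrable lborel {0..} (\<lambda>x. (cmod (g x + drift (f x)))\<^sup>2)"
proof -
  have eq: "(cmod (g x + drift (f x)))\<^sup>2 = ((cmod (g x))\<^sup>2 + (cmod (drift (f x)))\<^sup>2) + 2 * (drift (f x) \<bullet> g x)" for x
    by (simp add: power2_norm_eq_inner inner_add inner_commute)
  note i = set_integral_add(1)[OF L2g drift_square_integrable] set_integrable_mult_right[OF drift_inner_integrable, of 2]
  show "set_integrable lborel {0..} (\<lambda>x. (cmod (g x + drift (f x)))\<^sup>2)"
    unfolding eq by (intro set_integral_add(1) i)
  have "(LINT x:{0..}|lborel. (cmod (g x + drift (f x)))\<^sup>2) = energy f g + 2 * (LINT x:{0..}|lborel. drift (f x) \<bullet> g x)"
    unfolding eq energy_eq set_integral_add(2)[OF i] by simp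
  then show "energy f g = 2 * cost (cmod (f 0)) + (LINT x:{0..}|lborel. (cmod (g x + drift (f x)))\<^sup>2)"
    using drift_inner_Ici[of 0] by simp
qed

lemma energy_ge: "2 * cost (cmod (f 0)) \<le> energy f g"
proof -
  have "0 \<le> (LINT x:{0..}|lborel. (cmod (g x + drift (f x)))\<^sup>2)"
    unfolding set_lebesgue_integral_def by (intro Bochner_Integration.integral_nonneg) simp
  then show ?thesis using energy_square_completed by simp
qed

text \<open>The sign in the completed square is chosen separately on each side of \<open>x\<close>:
  minus on the way up, plus on the way down. The two cross terms integrate to 2 (\<open>cost\<close>
  at the peak - \<open>cost\<close> at the vertex) and 2 \<open>cost\<close> at the peak.\<close>

lemma energy_ge_peak:
  assumes "0 \<le> x"
  shows "4 * cost (cmod (f x)) - 2 * cost (cmod (f 0)) \<le> energy f g"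
proof -
  let ?h = "\<lambda>t. (cmod (g t))\<^sup>2 + (cmod (drift (f t)))\<^sup>2"
  have ih: "set_integrable lborel {0..} ?h" by (rule set_integral_add(1)[OF L2g drift_square_integrable])
  have sub: "set_integrable lborel {0..x} k" "set_integrable lborel {x..} k"
    if "set_integrable lborel {0..} k" for k :: "real \<Rightarrow> real"
    by (rule set_integrable_subset[OF that]; use assms in auto)+
  have ge: "c * (drift (f t) \<bullet> g t) \<le> ?h t" if "c = 2 \<or> c = - 2" for c t
  proof -
    have "0 \<le> (cmod (g t - drift (f t)))\<^sup>2" "0 \<le> (cmod (g t + drift (f t)))\<^sup>2" by simp_all
    then show ?thesis using that unfolding power2_norm_eq_inner by (auto simp: inner_diff inner_add inner_commute)
  qed
  have "(LINT t:{0..x}|lborel. 2 * (drift (f t) \<bullet> g t)) \<le> (LINT t:{0..x}|lborel. ?h t)"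
    by (intro set_integral_mono sub set_integrable_mult_right drift_inner_integrable ih ge) auto
  moreover have "(LINT t:{x..}|lborel. - 2 * (drift (f t) \<bullet> g t)) \<le> (LINT t:{x..}|lborel. ?h t)"
    by (intro set_integral_mono sub set_integrable_mult_right drift_inner_integrable ih ge) auto
  ultimately show ?thesis
    unfolding energy_eq set_integral_Ici_combine[OF assms ih] set_integral_mult_right
      drift_inner_Icc[OF order_refl assms] drift_inner_Ici[OF assms] by simp
qed

text \<open>Without remainder the completed square gives g = - \<open>drift\<close> f almost
  everywhere. Since \<open>drift\<close> along f is continuous, the integral form of the weak
  derivative upgrades this to a classical equation at every point, one-sided at 0.\<close>

lemma flow_equation:
  assumes "energy f g = 2 * cost (cmod (f 0))" and "0 \<le> x"
  shows "(f has_vector_derivative - drift (f x)) (at x within {0..})"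
proof -
  have "(LINT x:{0..}|lborel. (cmod (g x + drift (f x)))\<^sup>2) = 0"
    using energy_square_completed(1) assms by simp
  then have "AE x in lborel. indicator {0..} x *\<^sub>R (cmod (g x + drift (f x)))\<^sup>2 = 0"
    unfolding set_lebesgue_integral_def
    using energy_square_completed(2) unfolding set_integrable_def
    by (subst (asm) integral_nonneg_eq_0_iff_AE) auto
  then have ae: "AE x in lborel. 0 \<le> x \<longrightarrow> g x = - drift (f x)"
    by eventually_elim (auto split: split_indicator_asm simp: add_eq_0_iff2)
  have [measurable]: "(\<lambda>x. drift (f x)) \<in> borel_measurable borel"
    using continuous_drift_f by (rule borel_measurable_continuous_onI)
  have f: "f y = f 0 + integral {0..y} (\<lambda>x. - drift (f x))" if "0 \<le> y" for y
  proof -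
    have "f y - f 0 = (LINT t:{0..y}|lborel. g t)" by (rule weak_deriv_diff[OF weak_deriv order_refl that])
    also have "\<dots> = (LINT t:{0..y}|lborel. - drift (f t))"
      by (rule set_lebesgue_integral_cong_AE) (use ae in auto)
    also have "\<dots> = integral {0..y} (\<lambda>x. - drift (f x))"
      by (intro set_borel_integral_eq_integral borel_integrable_atLeastAtMost' continuous_intros
          continuous_on_subset[OF continuous_drift_f]) auto
    finally show ?thesis by (simp add: algebra_simps)
  qed
  have "((\<lambda>y. f 0 + integral {0..y} (\<lambda>x. - drift (f x))) has_vector_derivative 0 + - drift (f x)) (at x within {0..x+1})"
    by (intro has_vector_derivative_add has_vector_derivative_const integral_has_vector_derivative continuous_intros
          continuous_on_subset[OF continuous_drift_f]) (use assms in auto)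
  then have "(f has_vector_derivative 0 + - drift (f x)) (at x within {0..x+1})"
  proof (rule has_vector_derivative_transform[rotated 2])
    show "f y = f 0 + integral {0..y} (\<lambda>x. - drift (f x))" if "y \<in> {0..x+1}" for y
      by (rule f) (use that in simp)
  qed (use assms in auto)
  moreover have "at x within {0..x+1} = at x within {0..}"
    by (rule at_within_nhd[where S="{..<x+1}"]) auto
  ultimately show ?thesis by simp
qed

end

section \<open>Solving the flow equation of the equality case\<close>

text \<open>As long as the solution stays away from 0, \<^term>\<open>gpos (cmod (f x))\<close> has derivative 1.\<close>

lemma flow_gpos:
  assumes der: "\<And>x. 0 \<le> x \<Longrightarrow> (f has_vector_derivative - drift (f x)) (at x within {0..})"
    and f0: "cmod (f 0) = exp (- (a\<^sup>2) / 2)" and a: "0 < a"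
    and S: "convex S" "0 \<in> S" "S \<subseteq> {0..}" and nz: "\<And>x. x \<in> S \<Longrightarrow> f x \<noteq> 0" and x: "x \<in> S"
  shows "gpos (cmod (f x)) = x + a"
proof -
  let ?r = "\<lambda>x. f x \<bullet> f x"
  have dr: "(?r has_real_derivative - 2 * gpos (cmod (f x)) * ?r x) (at x within {0..})" if "0 \<le> x" for x
  proof -
    have "(?r has_vector_derivative f x \<bullet> - drift (f x) + - drift (f x) \<bullet> f x) (at x within {0..})"
      by (rule bounded_bilinear.has_vector_derivative[OF bounded_bilinear_inner der[OF that] der[OF that]])
    then show ?thesis
      unfolding has_real_derivative_iff_has_vector_derivative by (simp add: drift_def mult.assoc)
  qed
  have f0': "?r 0 = exp (- (a\<^sup>2))"
    using f0 by (simp add: power2_norm_eq_inner[symmetric] flip: exp_of_nat_mult)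
  \<comment> \<open>Staying strictly below height 1 keeps - ln |f|^2 away from 0, where the square
    root is not differentiable. The modulus does not increase along the flow, and
    \<open>0 < a\<close> puts its initial value below 1.\<close>
  have r1: "?r x < 1" if "0 \<le> x" for x
  proof -
    have "?r x \<le> ?r 0"
    proof (rule DERIV_nonpos_imp_decreasing_open[OF that])
      fix t assume t: "0 < t" "t < x"
      have "DERIV ?r t :> - 2 * gpos (cmod (f t)) * ?r t"
        using dr[of t] t at_within_interior[of t "{0..}"] by simp
      then show "\<exists>y. DERIV ?r t :> y \<and> y \<le> 0"
        by (intro exI[of _ "- 2 * gpos (cmod (f t)) * ?r t"]) (auto simp: gpos_nonneg)
    next
      show "continuous_on {0..x} ?r"
        by (rule continuous_on_subset[OF DERIV_continuous_on[OF dr]]) auto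
    qed
    then show ?thesis using f0' a by (simp add: order.strict_trans1[of _ "exp (- (a\<^sup>2))"])
  qed
  have g: "gpos (cmod (f x)) = sqrt (- ln (?r x))" if "x \<in> S" for x
  proof -
    have "0 < ?r x" "?r x < 1" using nz[OF that] r1[of x] that S by auto
    then have "0 \<le> - ln (?r x)" by simp
    then show ?thesis by (simp add: gpos_def power2_norm_eq_inner)
  qed
  have "\<exists>c. \<forall>x\<in>S. sqrt (- ln (?r x)) - x = c"
  proof (rule has_field_derivative_zero_constant[OF S(1)])
    fix x assume x: "x \<in> S"
    have pos: "0 < ?r x" "0 < - ln (?r x)" using nz[OF x] r1[of x] x S by auto
    have "(?r has_real_derivative - 2 * sqrt (- ln (?r x)) * ?r x) (at x within S)"
      using DERIV_subset[OF dr[of x] S(3)] x S g[OF x] by auto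
    then show "((\<lambda>x. sqrt (- ln (?r x)) - x) has_real_derivative 0) (at x within S)"
      using pos by (auto intro!: derivative_eq_intros simp: field_simps)
  qed
  then obtain c where c: "\<And>x. x \<in> S \<Longrightarrow> sqrt (- ln (?r x)) - x = c" by auto
  have "c = a" using c[OF S(2)] a unfolding f0' by simp
  then show ?thesis using c[OF x] g[OF x] by simp
qed

text \<open>Before a first zero X, \<open>flow_gpos\<close> on [0, X) determines the modulus as exp
  (- (y + a)^2 / 2), which is bounded below by its value at X; continuity excludes the zero. With
  \<open>gpos\<close> known on the whole half-line the equation becomes linear, f' = - (x + a) f,
  and exp ((x + a)^2 / 2) is an integrating factor that also preserves the phase.\<close>

lemma flow_gaussian:
  assumes der: "\<And>x. 0 \<le> x \<Longrightarrow> (f has_vector_derivative - drift (f x)) (at x within {0..})"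
    and f0: "cmod (f 0) = exp (- (a\<^sup>2) / 2)" and a: "0 < a" and x: "0 \<le> x"
  shows "f x = exp ((a\<^sup>2 - (x + a)\<^sup>2) / 2) *\<^sub>R f 0"
proof -
  have cont: "continuous_on {0..} f"
    using der by (auto simp: continuous_on_eq_continuous_within intro: has_vector_derivative_continuous)
  have nz: "f t \<noteq> 0" if "0 \<le> t" for t
  proof
    assume "f t = 0"
    define Z where "Z = {x\<in>{0..}. f x \<in> {0}}"
    have Z: "closed Z" unfolding Z_def by (rule continuous_closed_preimage[OF cont, unfolded vimage_def Int_def mem_Collect_eq]) auto
    have ne: "Z \<noteq> {}" and bd: "bdd_below Z" using that \<open>f t = 0\<close> by (auto simp: Z_def)
    define X where "X = Inf Z"
    have XZ: "X \<in> Z" unfolding X_def by (rule closed_contains_Inf[OF ne bd Z])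
    then have X: "0 \<le> X" "f X = 0" by (auto simp: Z_def)
    have "X \<noteq> 0" using X(2) f0 by auto
    then have X0: "0 < X" using X by simp
    have low: "exp (- ((X + a)\<^sup>2) / 2) \<le> cmod (f y)" if "y \<in> {0..<X}" for y
    proof -
      have nz: "f s \<noteq> 0" if "s \<in> {0..<X}" for s
        using that cInf_lower[OF _ bd, of s] by (auto simp: Z_def X_def)
      have g: "gpos (cmod (f y)) = y + a"
        by (rule flow_gpos[OF der f0 a _ _ _ nz that]) (use X0 in auto)
      \<comment> \<open>Above height 1 \<open>gpos\<close> would be 0, but here it is y + a >
        0.\<close>
      have "cmod (f y) \<le> 1"
      proof (rule ccontr)
        assume "\<not> cmod (f y) \<le> 1"
        then have "gpos (cmod (f y)) = 0" by (simp add: gpos_def)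
        then show False using g that a by simp
      qed
      then have "cmod (f y) = exp (- ((y + a)\<^sup>2) / 2)"
        using exp_gpos[of "cmod (f y)"] nz[OF that] unfolding g by simp
      moreover have "(y + a)\<^sup>2 \<le> (X + a)\<^sup>2" using that a by (intro power_mono) auto
      ultimately show ?thesis by simp
    qed
    have cl: "closure {0..<X} = {0..X}" using X0 by simp
    have "exp (- ((X + a)\<^sup>2) / 2) \<le> cmod (f X)"
    proof (rule continuous_ge_on_closure[where S="{0..<X}" and f="\<lambda>y. cmod (f y)"])
      show "continuous_on (closure {0..<X}) (\<lambda>y. cmod (f y))"
        unfolding cl by (intro continuous_intros continuous_on_subset[OF cont]) auto
      show "X \<in> closure {0..<X}" unfolding cl using X0 by simp
    qed (rule low)
    then show False using X(2) by simp
  qed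
  have gp: "gpos (cmod (f y)) = y + a" if "0 \<le> y" for y
    by (rule flow_gpos[OF der f0 a, of "{0..}"]) (use nz that in auto)
  have "\<exists>c. \<forall>x\<in>{0..}. exp ((x + a)\<^sup>2 / 2) *\<^sub>R f x = c"
  proof (rule has_vector_derivative_zero_constant)
    fix x :: real assume "x \<in> {0..}"
    then have d: "(f has_vector_derivative - ((x + a) *\<^sub>R f x)) (at x within {0..})"
      using der[of x] gp[of x] by (simp add: drift_def)
    have e: "((\<lambda>x. exp ((x + a)\<^sup>2 / 2)) has_real_derivative (x + a) * exp ((x + a)\<^sup>2 / 2)) (at x within {0..})"
      by (auto intro!: derivative_eq_intros)
    show "((\<lambda>x. exp ((x + a)\<^sup>2 / 2) *\<^sub>R f x) has_vector_derivative 0) (at x within {0..})"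
      using has_vector_derivative_scaleR[OF e d] by (simp add: algebra_simps)
  qed auto
  then obtain c where c: "exp ((y + a)\<^sup>2 / 2) *\<^sub>R f y = c" if "0 \<le> y" for y
    by (metis atLeast_iff)
  have "exp ((x + a)\<^sup>2 / 2) *\<^sub>R f x = exp (a\<^sup>2 / 2) *\<^sub>R f 0"
    using c[OF order_refl] unfolding c[OF x] by simp
  then have "exp (- ((x + a)\<^sup>2 / 2)) *\<^sub>R exp ((x + a)\<^sup>2 / 2) *\<^sub>R f x = exp (- ((x + a)\<^sup>2 / 2)) *\<^sub>R exp (a\<^sup>2 / 2) *\<^sub>R f 0"
    by (rule arg_cong)
  then show ?thesis by (simp add: diff_divide_distrib flip: exp_add)
qed

section \<open>Energy on the star graph\<close>

text \<open>An instance of ln s \<le> s - 1 at s = 1 / t. With t = l^2 the left side is the factor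
  of the energy along a ray of the Nehari set.\<close>

lemma mult_one_minus_ln_le_1:
  fixes t :: real
  assumes "0 < t"
  shows "t * (1 - ln t) \<le> 1"
proof -
  have "- ln t \<le> 1 / t - 1" using assms ln_le_minus_one[of "1 / t"] by (simp add: ln_div)
  then have "t * (1 - ln t) \<le> t * (1 / t)" using assms by (intro mult_left_mono) auto
  then show ?thesis using assms by simp
qed

lemma mult_one_minus_ln_eq_1:
  fixes t :: real
  assumes "0 < t" "t * (1 - ln t) = 1"
  shows "t = 1"
proof -
  have "1 - ln t = 1 / t" using assms by (simp add: field_simps)
  then have "ln (1 / t) = 1 / t - 1" using assms by (simp add: ln_div)
  then have "1 / t = 1" using assms by (intro ln_eq_minus_one) auto
  then show ?thesis by simp
qed

definition star_energy :: "nat \<Rightarrow> real \<Rightarrow> graph_fun \<Rightarrow> graph_fun \<Rightarrow> real" where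
  "star_energy N \<gamma> f g = (\<Sum>e=1..N. energy (f e) (g e)) - \<gamma> * (cmod (f 1 0))\<^sup>2"

definition star_mass :: "nat \<Rightarrow> graph_fun \<Rightarrow> real" where
  "star_mass N f = (\<Sum>e=1..N. mass (f e))"

locale star_fun =
  fixes N :: nat and f g :: graph_fun
  assumes edge: "e \<in> {1..N} \<Longrightarrow> half_line_fun (f e) (g e)"
    and vertex: "e \<in> {1..N} \<Longrightarrow> f e 0 = f 1 0"
begin

lemma scale_star_fun: "0 < l \<Longrightarrow> star_fun N (\<lambda>e x. l *\<^sub>R f e x) (\<lambda>e x. l *\<^sub>R g e x)"
proof (rule star_fun.intro)
  show "half_line_fun (\<lambda>x. l *\<^sub>R f e x) (\<lambda>x. l *\<^sub>R g e x)" if "0 < l" "e \<in> {1..N}" for e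
    by (rule half_line_fun.scale(1)[OF edge[OF that(2)] that(1)])
  show "l *\<^sub>R f e 0 = l *\<^sub>R f 1 0" if "e \<in> {1..N}" for e
    using vertex[OF that] by (rule arg_cong)
qed

lemma scale_star_mass:
  assumes "0 < l"
  shows "star_mass N (\<lambda>e x. l *\<^sub>R f e x) = l\<^sup>2 * star_mass N f"
  unfolding star_mass_def sum_distrib_left
  by (intro sum.cong half_line_fun.scale(2)[OF edge assms]) auto

lemma scale_star_energy:
  assumes "0 < l"
  shows "star_energy N \<gamma> (\<lambda>e x. l *\<^sub>R f e x) (\<lambda>e x. l *\<^sub>R g e x) =
    l\<^sup>2 * (star_energy N \<gamma> f g - ln (l\<^sup>2) * star_mass N f)"
proof -
  have "(\<Sum>e=1..N. energy (\<lambda>x. l *\<^sub>R f e x) (\<lambda>x. l *\<^sub>R g e x)) =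
      (\<Sum>e=1..N. l\<^sup>2 * (energy (f e) (g e) - ln (l\<^sup>2) * mass (f e)))"
    by (intro sum.cong half_line_fun.scale(3)[OF edge assms]) auto
  also have "\<dots> = l\<^sup>2 * ((\<Sum>e=1..N. energy (f e) (g e)) - ln (l\<^sup>2) * star_mass N f)"
    by (simp add: star_mass_def sum_distrib_left sum_subtractf right_diff_distrib)
  finally show ?thesis
    by (simp add: star_energy_def power_mult_distrib algebra_simps)
qed

lemma star_mass_nonneg: "0 \<le> star_mass N f"
  unfolding star_mass_def by (intro sum_nonneg half_line_fun.mass_nonneg[OF edge])

text \<open>At vertex height exp (- a^2 / 2) the term \<gamma> |f(0)|^2 with \<gamma> = N a equals N
  a exp (- a^2), the first summand of \<open>cost_exp\<close> added over the edges, so only N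
  \<open>gtail a\<close> is left. Equality of the sums forces equality on every edge, and each edge
  then solves the flow equation.\<close>

lemma star_energy_ge_vertex:
  assumes a: "0 < a"
    and le1: "\<And>e x. e \<in> {1..N} \<Longrightarrow> 0 \<le> x \<Longrightarrow> cmod (f e x) \<le> 1"
    and v: "cmod (f 1 0) = exp (- (a\<^sup>2) / 2)"
  shows "real N * gtail a \<le> star_energy N (real N * a) f g"
    and "star_energy N (real N * a) f g = real N * gtail a \<Longrightarrow> e \<in> {1..N} \<Longrightarrow> 0 \<le> x \<Longrightarrow>
      f e x = exp ((a\<^sup>2 - (x + a)\<^sup>2) / 2) *\<^sub>R f 1 0"
proof -
  have unit: "unit_half_line_fun (f e) (g e)" if "e \<in> {1..N}" for e
    using edge[OF that] le1[OF that] by (simp add: unit_half_line_fun_def unit_half_line_fun_axioms_def)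
  let ?c = "2 * cost (exp (- (a\<^sup>2) / 2))"
  have ve: "cmod (f e 0) = exp (- (a\<^sup>2) / 2)" if "e \<in> {1..N}" for e using v vertex[OF that] by simp
  have ge: "?c \<le> energy (f e) (g e)" if "e \<in> {1..N}" for e
    using unit_half_line_fun.energy_ge[OF unit[OF that]] unfolding ve[OF that] .
  have v2: "(cmod (f 1 0))\<^sup>2 = exp (- (a\<^sup>2))" unfolding v by (simp flip: exp_of_nat_mult)
  have c: "?c = a * exp (- (a\<^sup>2)) + gtail a" using cost_exp[of a] a by simp
  have E: "star_energy N (real N * a) f g - real N * gtail a = (\<Sum>e=1..N. energy (f e) (g e)) - (\<Sum>e=1..N. ?c)"
    unfolding star_energy_def v2 c by (simp add: algebra_simps)
  have "(\<Sum>e=1..N. ?c) \<le> (\<Sum>e=1..N. energy (f e) (g e))" by (intro sum_mono ge)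
  then show "real N * gtail a \<le> star_energy N (real N * a) f g" using E by linarith
  assume eq: "star_energy N (real N * a) f g = real N * gtail a" and e: "e \<in> {1..N}" and x: "0 \<le> x"
  have "(\<Sum>e=1..N. ?c) = (\<Sum>e=1..N. energy (f e) (g e))" using E eq by linarith
  from sum_mono_inv[OF this ge e] have "energy (f e) (g e) = 2 * cost (cmod (f e 0))"
    unfolding ve[OF e] by simp
  from flow_gaussian[OF unit_half_line_fun.flow_equation[OF unit[OF e] this] ve[OF e] a x]
  show "f e x = exp ((a\<^sup>2 - (x + a)\<^sup>2) / 2) *\<^sub>R f 1 0" using vertex[OF e] by simp
qed

text \<open>The edge with the peak pays 4 \<open>cost 1\<close> - 2 \<open>cost c\<close>, the other
  N - 1 edges pay at least 2 \<open>cost c\<close> each; this is where the coefficient N - 2 in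
  \<open>climbing_cost\<close> comes from.\<close>

lemma star_energy_gt_peak:
  assumes N: "N \<ge> 2" and a: "0 < a" and E: "real N * gtail a < sqrt pi"
    and le1: "\<And>e x. e \<in> {1..N} \<Longrightarrow> 0 \<le> x \<Longrightarrow> cmod (f e x) \<le> 1"
    and peak: "e0 \<in> {1..N}" "0 \<le> x0" "cmod (f e0 x0) = 1"
    and v: "cmod (f 1 0) \<le> exp (- (a\<^sup>2) / 2)"
  shows "real N * gtail a < star_energy N (real N * a) f g"
proof -
  have unit: "unit_half_line_fun (f e) (g e)" if "e \<in> {1..N}" for e
    using edge[OF that] le1[OF that] by (simp add: unit_half_line_fun_def unit_half_line_fun_axioms_def)
  let ?c = "cmod (f 1 0)"
  have ge: "2 * cost ?c \<le> energy (f e) (g e)" if "e \<in> {1..N}" for e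
    using unit_half_line_fun.energy_ge[OF unit[OF that]] vertex[OF that] by simp
  have "4 * cost 1 - 2 * cost ?c \<le> energy (f e0) (g e0)"
    using unit_half_line_fun.energy_ge_peak[OF unit[OF peak(1)] peak(2)] peak(3) vertex[OF peak(1)] by simp
  moreover have "(\<Sum>e\<in>{1..N} - {e0}. 2 * cost ?c) \<le> (\<Sum>e\<in>{1..N} - {e0}. energy (f e) (g e))"
    by (intro sum_mono ge) auto
  moreover have "(\<Sum>e\<in>{1..N} - {e0}. 2 * cost ?c) = (real N - 1) * (2 * cost ?c)"
    using peak(1) N by (simp add: of_nat_diff)
  moreover have "(\<Sum>e=1..N. energy (f e) (g e)) = energy (f e0) (g e0) + (\<Sum>e\<in>{1..N} - {e0}. energy (f e) (g e))"
    using peak(1) by (intro sum.remove) auto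
  ultimately have "2 * (real N - 2) * cost ?c + 4 * cost 1 - real N * a * ?c\<^sup>2 \<le> star_energy N (real N * a) f g"
    unfolding star_energy_def by (simp add: algebra_simps)
  then show ?thesis using climbing_cost[OF N a E _ v] by simp
qed

text \<open>The Gaussian shape is homogeneous in \<open>f\<close>, so it can be stated for the
  unscaled function; only the modulus at the vertex still refers to \<open>l\<close>.\<close>

lemma star_energy_scaled:
  assumes N: "N \<ge> 2" and a: "0 < a" and E: "real N * gtail a < sqrt pi"
    and nz: "\<exists>e\<in>{1..N}. \<exists>x\<ge>0. f e x \<noteq> 0"
  shows "\<exists>l>0. real N * gtail a \<le> star_energy N (real N * a) (\<lambda>e x. l *\<^sub>R f e x) (\<lambda>e x. l *\<^sub>R g e x) \<and>
    (star_energy N (real N * a) (\<lambda>e x. l *\<^sub>R f e x) (\<lambda>e x. l *\<^sub>R g e x) = real N * gtail a \<longrightarrow>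
      cmod (l *\<^sub>R f 1 0) = exp (- (a\<^sup>2) / 2) \<and>
      (\<forall>e\<in>{1..N}. \<forall>x\<ge>0. f e x = exp ((a\<^sup>2 - (x + a)\<^sup>2) / 2) *\<^sub>R f 1 0))"
proof -
  have "\<forall>e\<in>{1..N}. \<exists>x\<ge>0. \<forall>y\<ge>0. cmod (f e y) \<le> cmod (f e x)"
    using half_line_fun.sup_attained[OF edge] by blast
  then obtain xm where xm: "0 \<le> xm e" "0 \<le> y \<Longrightarrow> cmod (f e y) \<le> cmod (f e (xm e))"
    if "e \<in> {1..N}" for e y by metis
  have fin: "finite ((\<lambda>e. cmod (f e (xm e))) ` {1..N})" "(\<lambda>e. cmod (f e (xm e))) ` {1..N} \<noteq> {}"
    using N by auto
  define m where "m = Max ((\<lambda>e. cmod (f e (xm e))) ` {1..N})"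
  have "m \<in> (\<lambda>e. cmod (f e (xm e))) ` {1..N}" unfolding m_def by (rule Max_in[OF fin])
  then obtain e0 where e0: "e0 \<in> {1..N}" "m = cmod (f e0 (xm e0))" by auto
  have m: "cmod (f e x) \<le> m" if "e \<in> {1..N}" "0 \<le> x" for e x
    unfolding m_def by (rule order_trans[OF xm(2)[OF that] Max_ge[OF fin(1)]]) (use that in auto)
  have m0: "0 < m" using nz m by (metis norm_le_zero_iff not_le order_trans)
  let ?c = "cmod (f 1 0)" and ?h = "exp (- (a\<^sup>2) / 2)"
  show ?thesis
  \<comment> \<open>This is exactly the condition that lifting or lowering the vertex value to
    \<open>?h\<close> leaves the maximum at most 1. If it fails, scaling the maximum to 1 leaves the
    vertex value below \<open>?h\<close>.\<close>
  proof (cases "m * ?h \<le> ?c")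
    case True
    have c: "0 < ?c" by (rule less_le_trans[OF _ True]) (use m0 in simp)
    define l where "l = ?h / ?c"
    have l: "0 < l" using c by (simp add: l_def)
    interpret s: star_fun N "\<lambda>e x. l *\<^sub>R f e x" "\<lambda>e x. l *\<^sub>R g e x" by (rule scale_star_fun[OF l])
    have v: "cmod (l *\<^sub>R f 1 0) = ?h" using l c by (simp add: l_def)
    have lm: "l * m \<le> 1" using True c by (simp add: l_def field_simps)
    have le1: "cmod (l *\<^sub>R f e x) \<le> 1" if "e \<in> {1..N}" "0 \<le> x" for e x
    proof -
      have "l * cmod (f e x) \<le> l * m" using m[OF that] l by simp
      then have "l * cmod (f e x) \<le> 1" using lm by (rule order_trans)
      then show ?thesis using l by simp
    qed
    have "f e x = exp ((a\<^sup>2 - (x + a)\<^sup>2) / 2) *\<^sub>R f 1 0"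
      if "star_energy N (real N * a) (\<lambda>e x. l *\<^sub>R f e x) (\<lambda>e x. l *\<^sub>R g e x) = real N * gtail a"
        "e \<in> {1..N}" "0 \<le> x" for e x
    proof -
      have "l *\<^sub>R f e x = exp ((a\<^sup>2 - (x + a)\<^sup>2) / 2) *\<^sub>R l *\<^sub>R f 1 0"
        by (rule s.star_energy_ge_vertex(2)[OF a le1 v that])
      also have "\<dots> = l *\<^sub>R exp ((a\<^sup>2 - (x + a)\<^sup>2) / 2) *\<^sub>R f 1 0"
        by (rule scaleR_left_commute)
      finally show ?thesis using l by (simp only: scaleR_cancel_left) simp
    qed
    then show ?thesis using s.star_energy_ge_vertex(1)[OF a le1 v] l v by blast
  next
    case False
    define l where "l = 1 / m"
    have l: "0 < l" using m0 by (simp add: l_def)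
    interpret s: star_fun N "\<lambda>e x. l *\<^sub>R f e x" "\<lambda>e x. l *\<^sub>R g e x" by (rule scale_star_fun[OF l])
    have le1: "cmod (l *\<^sub>R f e x) \<le> 1" if "e \<in> {1..N}" "0 \<le> x" for e x
      using m[OF that] m0 by (simp add: l_def)
    have pk: "cmod (l *\<^sub>R f e0 (xm e0)) = 1" using e0(2) m0 by (simp add: l_def)
    have v: "cmod (l *\<^sub>R f 1 0) \<le> ?h" using False m0 by (simp add: l_def field_simps)
    have "real N * gtail a < star_energy N (real N * a) (\<lambda>e x. l *\<^sub>R f e x) (\<lambda>e x. l *\<^sub>R g e x)"
      by (rule s.star_energy_gt_peak[OF N a E le1 e0(1) xm(1)[OF e0(1)] pk v])
    then show ?thesis using l by (intro exI[of _ l]) auto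
  qed
qed

text \<open>Under the Nehari constraint the energy along the ray \<^term>\<open>l *\<^sub>R f e x\<close> is
  \<^term>\<open>l\<^sup>2 * (1 - ln (l\<^sup>2))\<close> times the mass, which is maximal exactly at \<^term>\<open>l = (1::real)\<close>.\<close>

lemma star_mass_ge:
  assumes N: "N \<ge> 2" and a: "0 < a" and E: "real N * gtail a < sqrt pi"
    and nz: "\<exists>e\<in>{1..N}. \<exists>x\<ge>0. f e x \<noteq> 0"
    and nehari: "star_energy N (real N * a) f g = star_mass N f"
  shows "real N * gtail a \<le> star_mass N f"
    and "star_mass N f = real N * gtail a \<Longrightarrow> cmod (f 1 0) = exp (- (a\<^sup>2) / 2) \<and>
      (\<forall>e\<in>{1..N}. \<forall>x\<ge>0. f e x = exp ((a\<^sup>2 - (x + a)\<^sup>2) / 2) *\<^sub>R f 1 0)"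
proof -
  let ?Q = "star_mass N f"
  obtain l where l: "0 < l" and
    ge: "real N * gtail a \<le> star_energy N (real N * a) (\<lambda>e x. l *\<^sub>R f e x) (\<lambda>e x. l *\<^sub>R g e x)" and
    eq: "star_energy N (real N * a) (\<lambda>e x. l *\<^sub>R f e x) (\<lambda>e x. l *\<^sub>R g e x) = real N * gtail a \<Longrightarrow>
      cmod (l *\<^sub>R f 1 0) = exp (- (a\<^sup>2) / 2) \<and>
      (\<forall>e\<in>{1..N}. \<forall>x\<ge>0. f e x = exp ((a\<^sup>2 - (x + a)\<^sup>2) / 2) *\<^sub>R f 1 0)"
    using star_energy_scaled[OF N a E nz] by blast
  let ?t = "l\<^sup>2"
  have t: "0 < ?t" using l by simp
  have T: "star_energy N (real N * a) (\<lambda>e x. l *\<^sub>R f e x) (\<lambda>e x. l *\<^sub>R g e x) = ?t * (1 - ln ?t) * ?Q"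
    unfolding scale_star_energy[OF l] nehari by (simp add: algebra_simps)
  have "?t * (1 - ln ?t) \<le> 1" by (rule mult_one_minus_ln_le_1[OF t])
  then have TQ: "?t * (1 - ln ?t) * ?Q \<le> 1 * ?Q" by (intro mult_right_mono star_mass_nonneg)
  then show "real N * gtail a \<le> ?Q" using ge T by simp
  assume Q: "?Q = real N * gtail a"
  have Q0: "0 < ?Q" unfolding Q using gtail_pos[of a] N a by simp
  \<comment> \<open>The energy at \<open>l\<close> lies between N \<open>gtail a\<close> and
    \<open>?Q\<close>; these now coincide, and as \<open>?Q\<close> is positive the scaling factor
    must be 1.\<close>
  have "?t * (1 - ln ?t) * ?Q = 1 * ?Q" using ge T TQ Q by linarith
  then have "?t * (1 - ln ?t) = 1" using Q0 by simp
  then have "?t = 1" by (rule mult_one_minus_ln_eq_1[OF t])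
  then have l1: "l = 1" using l by (simp add: power2_eq_1_iff)
  have "star_energy N (real N * a) (\<lambda>e x. l *\<^sub>R f e x) (\<lambda>e x. l *\<^sub>R g e x) = real N * gtail a"
    using ge T TQ Q by linarith
  from eq[OF this] show "cmod (f 1 0) = exp (- (a\<^sup>2) / 2) \<and>
      (\<forall>e\<in>{1..N}. \<forall>x\<ge>0. f e x = exp ((a\<^sup>2 - (x + a)\<^sup>2) / 2) *\<^sub>R f 1 0)"
    unfolding l1 scaleR_one .
qed

end

section \<open>From functions on the graph to continuous representatives\<close>

lemma dirichlet_half_eq:
  assumes "weak_deriv u g" "L2_half g"
  shows "dirichlet_half u = (LINT x:{0..}|lborel. (cmod (g x))\<^sup>2)"
proof -
  let ?h = "SOME g. weak_deriv u g \<and> L2_half g"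
  have h: "weak_deriv u ?h \<and> L2_half ?h" using someI_ex[of "\<lambda>g. weak_deriv u g \<and> L2_half g"] assms by blast
  \<comment> \<open>The indicator is moved inside the square because measurability is known only for
    its product with a weak derivative.\<close>
  have eq: "indicator {0..} x *\<^sub>R (cmod (k x))\<^sup>2 = (cmod (indicator {0..} x *\<^sub>R k x))\<^sup>2" for k :: "real \<Rightarrow> complex" and x :: real
    by (auto split: split_indicator)
  have "(LINT x:{0..}|lborel. (cmod (?h x))\<^sup>2) = (LINT x:{0..}|lborel. (cmod (g x))\<^sup>2)"
    unfolding set_lebesgue_integral_def eq
  proof (rule integral_cong_AE)
    have m: "(\<lambda>x. indicator {0..} x *\<^sub>R ?h x) \<in> borel_measurable borel"
      "(\<lambda>x. indicator {0..} x *\<^sub>R g x) \<in> borel_measurable borel"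
      using weak_deriv_measurable h assms(1) by blast+
    show "(\<lambda>x. (cmod (indicator {0..} x *\<^sub>R ?h x))\<^sup>2) \<in> borel_measurable lborel"
      "(\<lambda>x. (cmod (indicator {0..} x *\<^sub>R g x))\<^sup>2) \<in> borel_measurable lborel"
      using m by measurable
    show "AE x in lborel. (cmod (indicator {0..} x *\<^sub>R ?h x))\<^sup>2 = (cmod (indicator {0..} x *\<^sub>R g x))\<^sup>2"
      using weak_deriv_unique[OF conjunct1[OF h] assms(1)]
      by eventually_elim (auto split: split_indicator)
  qed
  then show ?thesis unfolding dirichlet_half_def half_line_integral_eq .
qed

lemma weak_deriv_cong:
  assumes "\<And>x. 0 \<le> x \<Longrightarrow> f x = f' x" "\<And>x. 0 \<le> x \<Longrightarrow> g x = g' x"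
  shows "weak_deriv f g \<longleftrightarrow> weak_deriv f' g'"
proof -
  have "set_integrable lborel {0..x} g \<longleftrightarrow> set_integrable lborel {0..x} g'" for x
    by (rule set_integrable_cong) (use assms in auto)
  moreover have "(LINT t:{0..x}|lborel. g t) = (LINT t:{0..x}|lborel. g' t)" for x
    by (rule set_lebesgue_integral_cong) (use assms in auto)
  ultimately show ?thesis unfolding weak_deriv_def using assms(1) by simp
qed

lemma L2_half_eq: "L2_half f \<longleftrightarrow> set_integrable lborel {0..} (\<lambda>x. (cmod (f x))\<^sup>2)"
  unfolding L2_half_def half_line_integrable_iff ..

lemma half_line_fun_exists:
  assumes "H1_half u" and ent: "set_integrable lborel {0<..} (\<lambda>x. (cmod (u x))\<^sup>2 * ln ((cmod (u x))\<^sup>2))"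
  shows "\<exists>f g. half_line_fun f g \<and> (\<forall>x\<ge>0. f x = u x)"
proof -
  obtain g where g: "weak_deriv u g" "L2_half g" and u: "L2_half u"
    using assms(1) unfolding H1_half_def by blast
  \<comment> \<open>To the left of 0 the value \<open>u 0\<close> is frozen, which keeps the
    function continuous, and the derivative is set to 0, which makes it Borel.\<close>
  let ?f = "\<lambda>x. u (max 0 x)" and ?g = "\<lambda>x. indicator {0..} x *\<^sub>R g x"
  have eq: "set_integrable lborel {0..} (\<lambda>x. P (k x)) \<longleftrightarrow> set_integrable lborel {0..} (\<lambda>x. P (h x))"
    if "\<And>x. 0 \<le> x \<Longrightarrow> k x = h x" for P :: "complex \<Rightarrow> real" and h k
    by (rule set_integrable_cong) (use that in auto)
  have "half_line_fun ?f ?g"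
  proof
    show "weak_deriv ?f ?g" using g(1) weak_deriv_cong[of u ?f g ?g] by simp
    show "continuous_on UNIV ?f"
      by (rule continuous_on_compose2[OF weak_deriv_continuous[OF g(1)]]) (auto intro!: continuous_intros)
    show "?g \<in> borel_measurable borel" by (rule weak_deriv_measurable[OF g(1)])
    show "set_integrable lborel {0..} (\<lambda>x. (cmod (?f x))\<^sup>2)"
      using u eq[of ?f u "\<lambda>z. (cmod z)\<^sup>2"] by (simp add: L2_half_eq)
    show "set_integrable lborel {0..} (\<lambda>x. (cmod (?g x))\<^sup>2)"
      using g(2) eq[of ?g g "\<lambda>z. (cmod z)\<^sup>2"] by (simp add: L2_half_eq)
    show "set_integrable lborel {0..} (\<lambda>x. (cmod (?f x))\<^sup>2 * ln ((cmod (?f x))\<^sup>2))"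
      using ent eq[of ?f u "\<lambda>z. (cmod z)\<^sup>2 * ln ((cmod z)\<^sup>2)"] by (simp add: half_line_integrable_iff)
  qed
  then show ?thesis by (intro exI[of _ ?f] exI[of _ ?g]) auto
qed

lemma half_line_fun_represents:
  assumes "half_line_fun f g" and u: "\<And>x. 0 \<le> x \<Longrightarrow> f x = u x"
  shows "H1_half u" "set_integrable lborel {0<..} (\<lambda>x. (cmod (u x))\<^sup>2 * ln ((cmod (u x))\<^sup>2))"
    and "(LINT x:{0<..}|lborel. (cmod (u x))\<^sup>2) = mass f"
    and "dirichlet_half u - (LINT x:{0<..}|lborel. (cmod (u x))\<^sup>2 * ln ((cmod (u x))\<^sup>2)) = energy f g"
proof -
  interpret half_line_fun f g by fact
  have eq: "set_integrable lborel {0..} (\<lambda>x. P (f x)) \<longleftrightarrow> set_integrable lborel {0..} (\<lambda>x. P (u x))"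
    for P :: "complex \<Rightarrow> real"
    by (rule set_integrable_cong) (use u in auto)
  have eq2: "(LINT x:{0<..}|lborel. P (u x)) = (LINT x:{0..}|lborel. P (f x))" for P :: "complex \<Rightarrow> real"
    unfolding half_line_integral_eq by (rule set_lebesgue_integral_cong) (use u in auto)
  have wu: "weak_deriv u g" using weak_deriv weak_deriv_cong[of f u g g] u by simp
  have g: "L2_half g" using L2g by (simp add: L2_half_eq)
  have "L2_half u" using L2f eq[of "\<lambda>z. (cmod z)\<^sup>2"] by (simp add: L2_half_eq)
  then show "H1_half u" unfolding H1_half_def using wu g by blast
  show "set_integrable lborel {0<..} (\<lambda>x. (cmod (u x))\<^sup>2 * ln ((cmod (u x))\<^sup>2))"
    using ent eq[of "\<lambda>z. (cmod z)\<^sup>2 * ln ((cmod z)\<^sup>2)"] by (simp add: half_line_integrable_iff)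
  show "(LINT x:{0<..}|lborel. (cmod (u x))\<^sup>2) = mass f" unfolding mass_def by (rule eq2)
  show "dirichlet_half u - (LINT x:{0<..}|lborel. (cmod (u x))\<^sup>2 * ln ((cmod (u x))\<^sup>2)) = energy f g"
    unfolding energy_def dirichlet_half_eq[OF wu g] eq2[of "\<lambda>z. (cmod z)\<^sup>2 * ln ((cmod z)\<^sup>2)"] ..
qed

lemma W_star_represented:
  assumes "W_star N u"
  shows "\<exists>f g. star_fun N f g \<and> (\<forall>e\<in>{1..N}. \<forall>x\<ge>0. f e x = u e x)"
proof -
  have "\<forall>e\<in>{1..N}. \<exists>f g. half_line_fun f g \<and> (\<forall>x\<ge>0. f x = u e x)"
    using assms half_line_fun_exists unfolding W_star_def H1_star_def by blast
  then obtain f g where fg: "\<And>e. e \<in> {1..N} \<Longrightarrow> half_line_fun (f e) (g e) \<and> (\<forall>x\<ge>0. f e x = u e x)"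
    by metis
  have v: "f e 0 = f 1 0" if "e \<in> {1..N}" for e
  proof -
    have "1 \<in> {1..N}" using that by auto
    then show ?thesis using fg that assms unfolding W_star_def H1_star_def by (metis order_refl)
  qed
  have "star_fun N f g"
  proof (rule star_fun.intro)
    show "half_line_fun (f e) (g e)" if "e \<in> {1..N}" for e using fg[OF that] by blast
  qed (rule v)
  then show ?thesis using fg by blast
qed

text \<open>By the last identity the action on the Nehari set is half the mass, so a lower bound for
  the mass suffices.\<close>

lemma star_fun_represents:
  assumes "star_fun N f g" and u: "\<forall>e\<in>{1..N}. \<forall>x\<ge>0. f e x = u e x" and N: "1 \<le> N"
  shows "W_star N u"
    and "I_nehari N \<omega> \<gamma> u = star_energy N \<gamma> f g + \<omega> * star_mass N f"
    and "S_act N \<omega> \<gamma> u = I_nehari N \<omega> \<gamma> u / 2 + star_mass N f / 2"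
proof -
  interpret star_fun N f g by fact
  have 1: "1 \<in> {1..N}" using N by simp
  note rep = half_line_fun_represents[OF edge, of _ "u _"]
  show "W_star N u"
    unfolding W_star_def H1_star_def
  proof (intro conjI ballI)
    fix e assume e: "e \<in> {1..N}"
    show "H1_half (u e)"
      "set_integrable lborel {0<..} (\<lambda>x. (cmod (u e x))\<^sup>2 * ln ((cmod (u e x))\<^sup>2))"
      using rep(1,2)[OF e, of e] u e by blast+
    have "f e 0 = u e 0" "f 1 0 = u 1 0" using u e 1 by auto
    then show "u e 0 = u 1 0" using vertex[OF e] by simp
  qed
  have Q: "L2_norm_sq N u = star_mass N f"
    unfolding L2_norm_sq_def star_mass_def by (intro sum.cong rep(3)) (use u in auto)
  have "(\<Sum>e=1..N. dirichlet_half (u e)) - entropy_int N u = (\<Sum>e=1..N. energy (f e) (g e))"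
    unfolding entropy_int_def sum_subtractf[symmetric] by (intro sum.cong rep(4)) (use u in auto)
  then have E: "F_form N \<gamma> u - entropy_int N u = star_energy N \<gamma> f g"
    unfolding F_form_def star_energy_def using u 1 by simp
  then show "I_nehari N \<omega> \<gamma> u = star_energy N \<gamma> f g + \<omega> * star_mass N f"
    unfolding I_nehari_def Q by simp
  show "S_act N \<omega> \<gamma> u = I_nehari N \<omega> \<gamma> u / 2 + star_mass N f / 2"
    unfolding S_act_def I_nehari_def Q by (simp add: field_simps)
qed

section \<open>The Gaussian profile and its level\<close>

lemma FTC_Ici:
  fixes f :: "real \<Rightarrow> real"
  assumes "f \<in> borel_measurable borel" "\<And>x. a \<le> x \<Longrightarrow> DERIV F x :> f x"
    "\<And>x. a \<le> x \<Longrightarrow> 0 \<le> f x" "(F \<longlongrightarrow> T) at_top"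
  shows "set_integrable lborel {a..} f" "(LINT x:{a..}|lborel. f x) = T - F a"
proof -
  have "F a \<le> T"
  proof (rule tendsto_lowerbound[OF assms(4)])
    show "\<forall>\<^sub>F x in at_top. F a \<le> F x"
      using eventually_ge_at_top[of a]
    proof eventually_elim
      case (elim x)
      then show ?case by (rule DERIV_nonneg_imp_nondecreasing) (use assms(2,3) in blast)
    qed
  qed simp
  have "(\<integral>\<^sup>+x. ennreal (indicator {a..} x *\<^sub>R f x) \<partial>lborel) = (\<integral>\<^sup>+x. ennreal (f x) * indicator {a ..} x \<partial>lborel)"
    by (intro nn_integral_cong) (auto split: split_indicator)
  also have "\<dots> = ennreal (T - F a)"
    by (rule nn_integral_FTC_atLeast) fact+
  finally have nn: "(\<integral>\<^sup>+x. ennreal (indicator {a..} x *\<^sub>R f x) \<partial>lborel) = ennreal (T - F a)" .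
  have "has_bochner_integral lborel (\<lambda>x. indicator {a..} x *\<^sub>R f x) (T - F a)"
    by (rule has_bochner_integral_nn_integral[OF _ _ _ nn])
      (use assms(1,3) \<open>F a \<le> T\<close> in \<open>auto split: split_indicator\<close>)
  then show "set_integrable lborel {a..} f" "(LINT x:{a..}|lborel. f x) = T - F a"
    unfolding set_integrable_def set_lebesgue_integral_def by (auto simp: has_bochner_integral_iff)
qed

lemma gaussian_integrals:
  assumes a: "0 < a"
  shows "set_integrable lborel {0..} (\<lambda>x. exp (- ((x + a)\<^sup>2)))"
    "(LINT x:{0..}|lborel. exp (- ((x + a)\<^sup>2))) = gtail a"
    "set_integrable lborel {0..} (\<lambda>x. (x + a)\<^sup>2 * exp (- ((x + a)\<^sup>2)))"
    "(LINT x:{0..}|lborel. (x + a)\<^sup>2 * exp (- ((x + a)\<^sup>2))) = (a * exp (- (a\<^sup>2)) + gtail a) / 2"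
proof -
  have d: "((\<lambda>x. gtail (x + a)) has_real_derivative - exp (- ((x + a)\<^sup>2))) (at x)" if "0 \<le> x" for x
  proof -
    have "(gtail has_real_derivative - exp (- ((x + a)\<^sup>2))) (at (x + a))"
      using gtail_derivative[of "x + a"] that a at_within_interior[of "x + a" "{0..}"] by simp
    moreover have "((\<lambda>x. x + a) has_real_derivative 1) (at x)" by (auto intro!: derivative_eq_intros)
    ultimately show ?thesis using DERIV_chain2[where f=gtail and g="\<lambda>x. x + a"] by fastforce
  qed
  have lim: "((\<lambda>x. gtail (x + a)) \<longlongrightarrow> 0) at_top"
    by (rule filterlim_compose[OF gtail_tendsto]) real_asymp
  have lim2: "((\<lambda>x. (x + a) * exp (- ((x + a)\<^sup>2))) \<longlongrightarrow> 0) at_top" by real_asymp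
  have 1: "DERIV (\<lambda>x. - gtail (x + a)) x :> exp (- ((x + a)\<^sup>2))" if "0 \<le> x" for x
    using DERIV_minus[OF d[OF that]] by simp
  have 2: "((\<lambda>x. - gtail (x + a)) \<longlongrightarrow> 0) at_top" using tendsto_minus[OF lim] by simp
  show "set_integrable lborel {0..} (\<lambda>x. exp (- ((x + a)\<^sup>2)))"
    by (rule FTC_Ici(1)[OF _ 1 _ 2]) auto
  show "(LINT x:{0..}|lborel. exp (- ((x + a)\<^sup>2))) = gtail a"
    by (subst FTC_Ici(2)[OF _ 1 _ 2]) auto
  \<comment> \<open>Integration by parts of y^2 exp (- y^2), written as y times y exp (- y^2), at y
    = x + a.\<close>
  let ?F = "\<lambda>x. - (((x + a) * exp (- ((x + a)\<^sup>2)) + gtail (x + a)) / 2)"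
  have 3: "DERIV ?F x :> (x + a)\<^sup>2 * exp (- ((x + a)\<^sup>2))" if "0 \<le> x" for x
  proof -
    have "((\<lambda>x. (x + a) * exp (- ((x + a)\<^sup>2))) has_real_derivative
        exp (- ((x + a)\<^sup>2)) - 2 * ((x + a)\<^sup>2 * exp (- ((x + a)\<^sup>2)))) (at x)"
    proof -
      have alg: "1 * E + (- (2 * y) * E) * y = E - 2 * (y\<^sup>2 * E)" for E y :: real
        by (simp add: power2_eq_square algebra_simps)
      have "((\<lambda>x. x + a) has_real_derivative 1) (at x)" by (auto intro!: derivative_eq_intros)
      moreover have "((\<lambda>x. exp (- ((x + a)\<^sup>2))) has_real_derivative - (2 * (x + a)) * exp (- ((x + a)\<^sup>2))) (at x)"
        by (auto intro!: derivative_eq_intros)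
      ultimately show ?thesis using DERIV_mult[of "\<lambda>x. x + a" 1 x UNIV] unfolding alg[symmetric] by blast
    qed
    from DERIV_minus[OF DERIV_cdivide[OF DERIV_add[OF this d[OF that]], of 2]] show ?thesis by simp
  qed
  have "(?F \<longlongrightarrow> - ((0 + 0) / 2)) at_top" by (intro tendsto_intros lim lim2) simp
  then have 4: "(?F \<longlongrightarrow> 0) at_top" by simp
  show "set_integrable lborel {0..} (\<lambda>x. (x + a)\<^sup>2 * exp (- ((x + a)\<^sup>2)))"
    by (rule FTC_Ici(1)[OF _ 3 _ 4]) auto
  show "(LINT x:{0..}|lborel. (x + a)\<^sup>2 * exp (- ((x + a)\<^sup>2))) = (a * exp (- (a\<^sup>2)) + gtail a) / 2"
    by (subst FTC_Ici(2)[OF _ 3 _ 4]) auto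
qed

text \<open>Here |g|^2 = (x + a)^2 |f|^2 = - |f|^2 ln(|f|^2): the gradient and entropy parts of the
  energy agree pointwise, so one integral is counted twice.\<close>

lemma gaussian_half_line_fun:
  fixes K :: complex
  assumes K: "cmod K = 1" and a: "0 < a"
  defines "f \<equiv> \<lambda>x. exp (- ((x + a)\<^sup>2) / 2) *\<^sub>R K"
  defines "g \<equiv> \<lambda>x. - (x + a) *\<^sub>R f x"
  shows "half_line_fun f g" "mass f = gtail a" "energy f g = a * exp (- (a\<^sup>2)) + gtail a"
proof -
  have f2: "(cmod (f x))\<^sup>2 = exp (- ((x + a)\<^sup>2))" for x
    using K by (simp add: f_def flip: exp_of_nat_mult)
  have g2: "(cmod (g x))\<^sup>2 = (x + a)\<^sup>2 * exp (- ((x + a)\<^sup>2))" for x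
    unfolding g_def norm_scaleR power_mult_distrib f2 power2_abs power2_minus ..
  have fe: "(cmod (f x))\<^sup>2 * ln ((cmod (f x))\<^sup>2) = - 1 * ((x + a)\<^sup>2 * exp (- ((x + a)\<^sup>2)))" for x
    unfolding f2 by simp
  note G = gaussian_integrals[OF a]
  have cg: "continuous_on S g" for S
    unfolding g_def f_def by (intro continuous_intros) auto
  have df: "(f has_vector_derivative g x) (at x within S)" for x S
  proof -
    have "((\<lambda>x. exp (- ((x + a)\<^sup>2) / 2)) has_real_derivative - (x + a) * exp (- ((x + a)\<^sup>2) / 2)) (at x within S)"
      by (auto intro!: derivative_eq_intros simp: field_simps)
    from has_vector_derivative_scaleR[OF this has_vector_derivative_const[of K]]
    show ?thesis unfolding f_def g_def by simp
  qed
  show "half_line_fun f g"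
  proof
    show "weak_deriv f g"
      unfolding weak_deriv_def
    proof (intro allI impI conjI)
      fix x :: real assume x: "0 \<le> x"
      show "set_integrable lborel {0..x} g" by (intro borel_integrable_atLeastAtMost' cg)
      have "(LINT t:{0..x}|lborel. g t) = f x - f 0"
        unfolding set_lebesgue_integral_def by (rule integral_FTC_Icc[OF x df cg])
      then show "f x = f 0 + (LINT t:{0..x}|lborel. g t)" by simp
    qed
    show "continuous_on UNIV f" unfolding f_def by (intro continuous_intros) auto
    show "g \<in> borel_measurable borel" using cg by (rule borel_measurable_continuous_onI)
    show "set_integrable lborel {0..} (\<lambda>x. (cmod (f x))\<^sup>2)" unfolding f2 by (rule G)
    show "set_integrable lborel {0..} (\<lambda>x. (cmod (g x))\<^sup>2)" unfolding g2 by (rule G)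
    show "set_integrable lborel {0..} (\<lambda>x. (cmod (f x))\<^sup>2 * ln ((cmod (f x))\<^sup>2))"
      unfolding fe by (intro set_integrable_mult_right G)
  qed
  show "mass f = gtail a" unfolding mass_def f2 by (rule G)
  show "energy f g = a * exp (- (a\<^sup>2)) + gtail a"
    unfolding energy_def fe g2 set_integral_mult_right G by (simp add: field_simps)
qed

text \<open>For the Gaussian of vertex height exp (- a^2 / 2) the star energy equals the star mass.
  The amplitude exp ((\<omega> + 1) / 2) subtracts \<omega> + 1 times the mass from the energy,
  which is what makes the Nehari functional vanish.\<close>

lemma phase_phi0_critical:
  assumes N: "1 \<le> N" and a: "0 < \<gamma> / real N"
    and u: "\<forall>e\<in>{1..N}. \<forall>x\<ge>0. u e x = cis \<theta> * complex_of_real (phi0 N \<omega> \<gamma> x)"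
  shows "W_star N u" "I_nehari N \<omega> \<gamma> u = 0" "\<not> is_zero_star N u"
    "S_act N \<omega> \<gamma> u = exp (\<omega> + 1) * (real N * gtail (\<gamma> / real N)) / 2"
proof -
  let ?a = "\<gamma> / real N"
  let ?f = "\<lambda>(e::nat) x. exp (- ((x + ?a)\<^sup>2) / 2) *\<^sub>R cis \<theta>"
  let ?g = "\<lambda>e x. - (x + ?a) *\<^sub>R ?f e x"
  note G = gaussian_half_line_fun[OF norm_cis[of \<theta>] a]
  interpret s0: star_fun N ?f ?g by (rule star_fun.intro) (rule G(1), simp)
  let ?M = "exp ((\<omega> + 1) / 2)"
  have M: "0 < ?M" by simp
  have M2: "?M\<^sup>2 = exp (\<omega> + 1)" by (simp flip: exp_of_nat_mult)
  have m: "star_mass N ?f = real N * gtail ?a"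
    unfolding star_mass_def using G(2) by simp
  have v: "(cmod (?f 1 0))\<^sup>2 = exp (- (?a\<^sup>2))" by (simp flip: exp_of_nat_mult)
  have "(\<Sum>e=1..N. energy (?f e) (?g e)) = real N * (?a * exp (- (?a\<^sup>2)) + gtail ?a)"
    unfolding G(3) by simp
  moreover have "\<gamma> * exp (- (?a\<^sup>2)) = real N * (?a * exp (- (?a\<^sup>2)))" using N by simp
  ultimately have e: "star_energy N \<gamma> ?f ?g = real N * gtail ?a"
    unfolding star_energy_def v distrib_left by linarith
  have rep: "\<forall>e\<in>{1..N}. \<forall>x\<ge>0. ?M *\<^sub>R ?f e x = u e x"
    using u by (simp add: phi0_def scaleR_conv_of_real mult_ac)
  note R = star_fun_represents[OF s0.scale_star_fun[OF M] rep N]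
  show "W_star N u" by (rule R(1))
  show I: "I_nehari N \<omega> \<gamma> u = 0"
    unfolding R(2) s0.scale_star_energy[OF M] s0.scale_star_mass[OF M] e m unfolding M2 by (simp add: algebra_simps)
  show "S_act N \<omega> \<gamma> u = exp (\<omega> + 1) * (real N * gtail ?a) / 2"
    unfolding R(3) I unfolding s0.scale_star_mass[OF M] m M2 by simp
  have "u 1 0 \<noteq> 0" using u N by (auto simp: phi0_def)
  then show "\<not> is_zero_star N u" unfolding is_zero_star_def using N by auto
qed

section \<open>The sharp lower bound for the action and its equality case\<close>

lemma S_act_ge:
  assumes N: "N \<ge> 2" and g: "\<gamma> > gamma_star N"
    and W: "W_star N u" and nz: "\<not> is_zero_star N u" and I: "I_nehari N \<omega> \<gamma> u = 0"
  shows "exp (\<omega> + 1) * (real N * gtail (\<gamma> / real N)) / 2 \<le> S_act N \<omega> \<gamma> u"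
    and "S_act N \<omega> \<gamma> u = exp (\<omega> + 1) * (real N * gtail (\<gamma> / real N)) / 2 \<Longrightarrow>
      \<exists>\<theta>. \<forall>e\<in>{1..N}. \<forall>x\<ge>0. u e x = cis \<theta> * complex_of_real (phi0 N \<omega> \<gamma> x)"
proof -
  let ?a = "\<gamma> / real N" and ?M = "exp ((\<omega> + 1) / 2)"
  let ?l = "1 / ?M"
  have gN: "real N * ?a = \<gamma>" and N1: "1 \<le> N" using N by auto
  note a = gamma_star_less[OF N g]
  obtain f g where fg: "star_fun N f g" and u: "\<forall>e\<in>{1..N}. \<forall>x\<ge>0. f e x = u e x"
    using W_star_represented[OF W] by blast
  interpret star_fun N f g by (rule fg)
  note R = star_fun_represents[OF fg u N1]
  have l: "0 < ?l" by simp
  have l2: "?l\<^sup>2 = 1 / exp (\<omega> + 1)" by (simp add: power_divide flip: exp_of_nat_mult)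
  interpret s: star_fun N "\<lambda>e x. ?l *\<^sub>R f e x" "\<lambda>e x. ?l *\<^sub>R g e x" by (rule scale_star_fun[OF l])
  have lnl: "ln (?l\<^sup>2) = - (\<omega> + 1)" unfolding l2 by (simp add: ln_div)
  have SE: "star_energy N \<gamma> f g = - \<omega> * star_mass N f" using I R(2)[of \<omega> \<gamma>] by simp
  \<comment> \<open>Since ln (l^2) = - (\<omega> + 1), the constraint energy = - \<omega> mass turns
    into energy = mass for the rescaled function.\<close>
  have "star_energy N \<gamma> f g - ln (?l\<^sup>2) * star_mass N f = star_mass N f"
    unfolding lnl SE by (simp add: algebra_simps)
  then have neh: "star_energy N (real N * ?a) (\<lambda>e x. ?l *\<^sub>R f e x) (\<lambda>e x. ?l *\<^sub>R g e x) = star_mass N (\<lambda>e x. ?l *\<^sub>R f e x)"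
    unfolding gN scale_star_energy[OF l] scale_star_mass[OF l] by (rule arg_cong)
  have nz': "\<exists>e\<in>{1..N}. \<exists>x\<ge>0. ?l *\<^sub>R f e x \<noteq> 0"
    using nz u l unfolding is_zero_star_def by (metis less_irrefl scaleR_eq_0_iff)
  have S: "S_act N \<omega> \<gamma> u = exp (\<omega> + 1) * star_mass N (\<lambda>e x. ?l *\<^sub>R f e x) / 2"
    unfolding R(3) I scale_star_mass[OF l] l2 by simp
  note main = s.star_mass_ge[OF N a nz' neh]
  show "exp (\<omega> + 1) * (real N * gtail ?a) / 2 \<le> S_act N \<omega> \<gamma> u"
    unfolding S using main(1) by simp
  assume "S_act N \<omega> \<gamma> u = exp (\<omega> + 1) * (real N * gtail ?a) / 2"
  then have "star_mass N (\<lambda>e x. ?l *\<^sub>R f e x) = real N * gtail ?a" unfolding S by simp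
  from main(2)[OF this] have v: "cmod (?l *\<^sub>R f 1 0) = exp (- (?a\<^sup>2) / 2)"
    and eq: "\<And>e x. e \<in> {1..N} \<Longrightarrow> 0 \<le> x \<Longrightarrow> ?l *\<^sub>R f e x = exp ((?a\<^sup>2 - (x + ?a)\<^sup>2) / 2) *\<^sub>R ?l *\<^sub>R f 1 0"
    by blast+
  \<comment> \<open>The value of the Gaussian continued to its peak at x = - a. It has modulus 1, so
    it is the phase sought.\<close>
  define z where "z = exp (?a\<^sup>2 / 2) *\<^sub>R ?l *\<^sub>R f 1 0"
  have "cmod z = exp (?a\<^sup>2 / 2) * exp (- (?a\<^sup>2) / 2)" unfolding z_def norm_scaleR[of "exp _"] v by simp
  also have "\<dots> = 1" by (simp flip: exp_add)
  finally obtain \<theta> where \<theta>: "z = cis \<theta>" by (metis cis_Arg_unique rcis_cmod_Arg rcis_def mult_1 of_real_1)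
  have "u e x = cis \<theta> * complex_of_real (phi0 N \<omega> \<gamma> x)" if e: "e \<in> {1..N}" and x: "0 \<le> x" for e x
  proof -
    have "?l *\<^sub>R f e x = exp (- ((x + ?a)\<^sup>2) / 2) *\<^sub>R exp (?a\<^sup>2 / 2) *\<^sub>R ?l *\<^sub>R f 1 0"
      unfolding eq[OF e x] by (simp add: diff_divide_distrib flip: exp_add)
    then have "?l *\<^sub>R f e x = exp (- ((x + ?a)\<^sup>2) / 2) *\<^sub>R cis \<theta>"
      unfolding \<theta>[symmetric] z_def .
    then have "?M *\<^sub>R ?l *\<^sub>R f e x = ?M *\<^sub>R exp (- ((x + ?a)\<^sup>2) / 2) *\<^sub>R cis \<theta>" by (rule arg_cong)
    then show ?thesis using u e x by (simp add: phi0_def scaleR_conv_of_real mult_ac)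
  qed
  then show "\<exists>\<theta>. \<forall>e\<in>{1..N}. \<forall>x\<ge>0. u e x = cis \<theta> * complex_of_real (phi0 N \<omega> \<gamma> x)" by blast
qed

theorem theorem1p4:
  fixes N :: nat and \<omega> \<gamma> :: real
  assumes "N \<ge> 2" and "\<gamma> > gamma_star N"
  shows "(\<exists>u. ground_state N \<omega> \<gamma> u) \<and>
         (\<forall>u. ground_state N \<omega> \<gamma> u \<longleftrightarrow>
             (\<exists>\<theta>::real. \<forall>e\<in>{1..N}. \<forall>x\<ge>0. u e x = cis \<theta> * complex_of_real (phi0 N \<omega> \<gamma> x)))"
proof -
  let ?L = "exp (\<omega> + 1) * (real N * gtail (\<gamma> / real N)) / 2"
  have N1: "1 \<le> N" using assms by simp
  note crit = phase_phi0_critical[OF N1 gamma_star_less(1)[OF assms]]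
  let ?A = "{S_act N \<omega> \<gamma> u | u. W_star N u \<and> \<not> is_zero_star N u \<and> I_nehari N \<omega> \<gamma> u = 0}"
  define u0 :: graph_fun where "u0 = (\<lambda>e x. cis 0 * complex_of_real (phi0 N \<omega> \<gamma> x))"
  have u0: "\<forall>e\<in>{1..N}. \<forall>x\<ge>0. u0 e x = cis 0 * complex_of_real (phi0 N \<omega> \<gamma> x)" by (simp add: u0_def)
  have "?L \<in> ?A" using crit[OF u0] by (metis (mono_tags, lifting) mem_Collect_eq)
  moreover have "?L \<le> s" if "s \<in> ?A" for s using that S_act_ge(1)[OF assms] by blast
  \<comment> \<open>As an attained lower bound, \<open>?L\<close> is a true minimum, so
    \<open>d_level\<close> is not a default value of \<open>Inf\<close>.\<close>
  ultimately have "Inf ?A = ?L" by (rule cInf_eq_minimum)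
  then have d: "d_level N \<omega> \<gamma> = ?L" unfolding d_level_def .
  have iff: "ground_state N \<omega> \<gamma> u \<longleftrightarrow>
      (\<exists>\<theta>. \<forall>e\<in>{1..N}. \<forall>x\<ge>0. u e x = cis \<theta> * complex_of_real (phi0 N \<omega> \<gamma> x))" for u
    unfolding ground_state_def d using crit S_act_ge(2)[OF assms] by blast
  then show ?thesis using u0 by blast
qed

end
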